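(* Let $\beta=4\,\frac{p-1}{p}$ and let $0<c<1$. The origin $(0,0)$ is a regular boundary point, for the equation $u_t=\mathcal{A}_pu$, of the domain enclosed by the hypersurfaces $$\{(x,t)\in\mathbb{R}^n\times(-\infty,0) : |x|^2=-\beta t\log|\log|t||\}\quad\text{and}\quad\{t=-c\},$$ that is, of $\Omega=\{(x,t)\in\mathbb{R}^n\times(-c,0) : |x|^2<-\beta t\log|\log|t||\}$.
   Context: Fix an integer $n\ge1$ and $1<p<\infty$. Points of $\mathbb{R}^n\times\mathbb{R}$ are written $\zeta=(x,t)$; $Du$ and $D^2u$ are the gradient and Hessian in the spatial variable $x$ only. $\partial\Omega$ is the Euclidean boundary of a domain $\Omega\subset\mathbb{R}^n\times(-\infty,\infty)$. The normalised $p$-parabolic equation is $u_t=\mathcal{A}_pu$, where, for $Du\neq0$, $$\mathcal{A}_pu=\frac1p|Du|^{2-p}\,\mathrm{div}(|Du|^{p-2}Du)=\frac1p\mathrm{tr}(D^2u)+\frac{p-2}{p}\left\langle D^2u\frac{Du}{|Du|},\frac{Du}{|Du|}\right\rangle .$$ Viscosity solutions. For a symmetric matrix $X$ let $\lambda(X)$ and $\Lambda(X)$ be its smallest and largest eigenvalues. A lower semicontinuous $u\in L^\infty(\Omega)$ is a viscosity supersolution in $\Omega$ if, whenever $\phi\in C^2(\Omega)$ and $u-\phi$ has a minimum at $\zeta_0\in\Omega$, one has $\phi_t(\zeta_0)-\mathcal{A}_p\phi(\zeta_0)\ge0$ if $D\phi(\zeta_0)\ne0$, and $\phi_t(\zeta_0)-\frac1p\mathrm{tr}(D^2\phi(\zeta_0))-\frac{p-2}{p}\lambda(D^2\phi(\zeta_0))\ge0$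 if $D\phi(\zeta_0)=0$. An upper semicontinuous $u\in L^\infty(\Omega)$ is a viscosity subsolution in $\Omega$ if, whenever $\phi\in C^2(\Omega)$ and $u-\phi$ has a maximum at $\zeta_0\in\Omega$, one has $\phi_t(\zeta_0)-\mathcal{A}_p\phi(\zeta_0)\le0$ if $D\phi(\zeta_0)\ne0$, and $\phi_t(\zeta_0)-\frac1p\mathrm{tr}(D^2\phi(\zeta_0))-\frac{p-2}{p}\Lambda(D^2\phi(\zeta_0))\le0$ if $D\phi(\zeta_0)=0$. (These are the conditions for $p\ge2$; for $1<p<2$, $\lambda$ and $\Lambda$ are interchanged, so that at $D\phi=0$ the operator is always replaced by its lower semicontinuous envelope for supersolutions and its upper semicontinuous envelope for subsolutions.) Perron solution and regularity. For a bounded continuous $f:\partial\Omega\to\mathbb{R}$, let $\mathcal{L}_f$ be the class of viscosity subsolutions $v$ in $\Omega$ with $\limsup_{\eta\to\zeta}v(\eta)\le f(\zeta)$ for all $\zeta\in\partial\Omega$, and let $\underline{H}_f(\zeta)=\sup\{v(\zeta):v\in\mathcal{L}_f\}$ (lower Perron solution). A point $\zeta_0\in\partial\Omega$ is regular if $\lim_{\Omega\ni\zeta\to\zeta_0}\underline{H}_f(\zeta)=f(\zeta_0)$ for every bounded continuous $f:\partial\Omega\to\mathbb{R}$. *)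

theory Defs
  imports "HOL-Analysis.Analysis"
begin

text \<open>
  Space-time points are pairs \<open>(x, t)\<close> of type \<open>(real ^ 'n) \<times> real\<close>, whose product norm is the
  Euclidean one. Functions on a set \<open>\<Omega>\<close> are total functions of which only the values on \<open>\<Omega>\<close>
  (respectively, for boundary data, on \<open>frontier \<Omega>\<close>) matter.
\<close>

definition spatial_gradient ::
    "((real ^ 'n) \<times> real \<Rightarrow> real) \<Rightarrow> (real ^ 'n) \<times> real \<Rightarrow> real ^ 'n" where
  "spatial_gradient u = (\<lambda>(x, t). \<chi> i. frechet_derivative (\<lambda>y. u (y, t)) (at x) (axis i 1))"

definition spatial_hessian ::
    "((real ^ 'n) \<times> real \<Rightarrow> real) \<Rightarrow> (real ^ 'n) \<times> real \<Rightarrow> real ^ 'n ^ 'n" where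
  "spatial_hessian u = (\<lambda>(x, t). jacobian (\<lambda>y. spatial_gradient u (y, t)) (at x))"

definition time_derivative ::
    "((real ^ 'n) \<times> real \<Rightarrow> real) \<Rightarrow> (real ^ 'n) \<times> real \<Rightarrow> real" where
  "time_derivative u = (\<lambda>(x, t). deriv (\<lambda>s. u (x, s)) t)"

text \<open>Meant for open \<open>\<Omega>\<close>; on space-time this is joint \<open>C\<^sup>2\<close> regularity in \<open>(x, t)\<close>.\<close>

definition C2_on :: "'a::real_normed_vector set \<Rightarrow> ('a \<Rightarrow> real) \<Rightarrow> bool" where
  "C2_on \<Omega> \<phi> \<longleftrightarrow>
    (\<exists>(\<phi>' :: 'a \<Rightarrow> 'a \<Rightarrow>\<^sub>L real) (\<phi>'' :: 'a \<Rightarrow> 'a \<Rightarrow>\<^sub>L ('a \<Rightarrow>\<^sub>L real)).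
      (\<forall>z\<in>\<Omega>. (\<phi> has_derivative blinfun_apply (\<phi>' z)) (at z)) \<and>
      (\<forall>z\<in>\<Omega>. (\<phi>' has_derivative blinfun_apply (\<phi>'' z)) (at z)) \<and>
      continuous_on \<Omega> \<phi>'')"

definition real_eigenvalues :: "real ^ 'n ^ 'n \<Rightarrow> real set" where
  "real_eigenvalues X = {l. \<exists>v. v \<noteq> 0 \<and> X *v v = l *\<^sub>R v}"

text \<open>
  For symmetric matrices the set of real eigenvalues is finite and nonempty, so that \<open>Min\<close> and
  \<open>Max\<close> are meaningful; they are only applied to Hessians of \<open>C\<^sup>2\<close> functions.
\<close>

definition min_eigenvalue :: "real ^ 'n ^ 'n \<Rightarrow> real" where
  "min_eigenvalue X = Min (real_eigenvalues X)"

definition max_eigenvalue :: "real ^ 'n ^ 'n \<Rightarrow> real" where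
  "max_eigenvalue X = Max (real_eigenvalues X)"

text \<open>
  The normalised \<open>p\<close>-Laplacian \<open>(1/p) |Du|\<^bsup>2-p\<^esup> div (|Du|\<^bsup>p-2\<^esup> Du)\<close> in expanded form,
  for use where \<open>Du \<noteq> 0\<close>.
\<close>

definition normalised_p_laplacian ::
    "real \<Rightarrow> ((real ^ 'n) \<times> real \<Rightarrow> real) \<Rightarrow> (real ^ 'n) \<times> real \<Rightarrow> real" where
  "normalised_p_laplacian p u z =
    (let X = spatial_hessian u z; q = spatial_gradient u z; \<nu> = (1 / norm q) *\<^sub>R q
     in 1 / p * trace X + (p - 2) / p * ((X *v \<nu>) \<bullet> \<nu>))"

definition upper_semicontinuous_on :: "'a::topological_space set \<Rightarrow> ('a \<Rightarrow> real) \<Rightarrow> bool" where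
  "upper_semicontinuous_on \<Omega> u \<longleftrightarrow>
    (\<forall>z\<in>\<Omega>. \<forall>a. u z < a \<longrightarrow> (\<forall>\<^sub>F w in at z within \<Omega>. u w < a))"

definition essentially_bounded_on :: "'a::euclidean_space set \<Rightarrow> ('a \<Rightarrow> real) \<Rightarrow> bool" where
  "essentially_bounded_on \<Omega> u \<longleftrightarrow>
    u \<in> borel_measurable (lebesgue_on \<Omega>) \<and> (\<exists>M. AE z in lebesgue_on \<Omega>. \<bar>u z\<bar> \<le> M)"

text \<open>
  Where the spatial gradient of the test function vanishes, the operator is replaced by its upper
  semicontinuous envelope, which involves the largest eigenvalue if \<open>p \<ge> 2\<close> and the smallest one
  if \<open>p < 2\<close>. The maximum of \<open>u - \<phi>\<close> is a maximum over all of \<open>\<Omega>\<close>.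
\<close>

definition viscosity_subsolution ::
    "real \<Rightarrow> ((real ^ 'n) \<times> real) set \<Rightarrow> ((real ^ 'n) \<times> real \<Rightarrow> real) \<Rightarrow> bool" where
  "viscosity_subsolution p \<Omega> u \<longleftrightarrow>
    upper_semicontinuous_on \<Omega> u \<and> essentially_bounded_on \<Omega> u \<and>
    (\<forall>\<phi> z. C2_on \<Omega> \<phi> \<and> z \<in> \<Omega> \<and> (\<forall>w\<in>\<Omega>. u w - \<phi> w \<le> u z - \<phi> z) \<longrightarrow>
      (spatial_gradient \<phi> z \<noteq> 0 \<longrightarrow>
        time_derivative \<phi> z - normalised_p_laplacian p \<phi> z \<le> 0) \<and>
      (spatial_gradient \<phi> z = 0 \<longrightarrow>
        time_derivative \<phi> z - 1 / p * trace (spatial_hessian \<phi> z)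
          - (p - 2) / p * (if p \<ge> 2 then max_eigenvalue (spatial_hessian \<phi> z)
                           else min_eigenvalue (spatial_hessian \<phi> z)) \<le> 0))"

definition perron_lower_class ::
    "real \<Rightarrow> ((real ^ 'n) \<times> real) set \<Rightarrow> ((real ^ 'n) \<times> real \<Rightarrow> real) \<Rightarrow>
      ((real ^ 'n) \<times> real \<Rightarrow> real) set" where
  "perron_lower_class p \<Omega> f =
    {v. viscosity_subsolution p \<Omega> v \<and>
        (\<forall>\<zeta>\<in>frontier \<Omega>. Limsup (at \<zeta> within \<Omega>) (\<lambda>\<eta>. ereal (v \<eta>)) \<le> ereal (f \<zeta>))}"

definition lower_perron_solution ::
    "real \<Rightarrow> ((real ^ 'n) \<times> real) set \<Rightarrow> ((real ^ 'n) \<times> real \<Rightarrow> real) \<Rightarrow>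
      (real ^ 'n) \<times> real \<Rightarrow> ereal" where
  "lower_perron_solution p \<Omega> f \<zeta> = (SUP v\<in>perron_lower_class p \<Omega> f. ereal (v \<zeta>))"

definition regular_boundary_point ::
    "real \<Rightarrow> ((real ^ 'n) \<times> real) set \<Rightarrow> (real ^ 'n) \<times> real \<Rightarrow> bool" where
  "regular_boundary_point p \<Omega> \<zeta>\<^sub>0 \<longleftrightarrow>
    \<zeta>\<^sub>0 \<in> frontier \<Omega> \<and>
    (\<forall>f. continuous_on (frontier \<Omega>) f \<and> bounded (f ` frontier \<Omega>) \<longrightarrow>
      (lower_perron_solution p \<Omega> f \<longlongrightarrow> ereal (f \<zeta>\<^sub>0)) (at \<zeta>\<^sub>0 within \<Omega>))"

end

theory Submission
  imports Defs
begin

text \<open>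
  The proof constructs a barrier: a function \<open>w\<close> that is positive on \<open>\<Omega>\<close>, tends to \<open>0\<close> at the
  origin, stays away from \<open>0\<close> outside each neighbourhood of the origin, and is a strict classical
  supersolution. Write \<open>h = - t\<close>, \<open>s = - ln h\<close> and \<open>E = exp ((norm x)\<^sup>2 / (\<beta> h))\<close>. The domain is the
  set where \<open>E < s\<close>, and the barrier is \<open>w = s\<^bsup>-1/8\<^esup> - s\<^bsup>-9/8\<^esup> E / 2\<close>. Positivity and the limit at
  the origin are immediate from \<open>E < s\<close>. For \<open>\<beta> = 4 (p - 1) / p\<close> the quadratic terms in \<open>x\<close> cancel
  in the equation and leave
  \<open>h (w\<^sub>t - \<A>\<^sub>p w) = - s\<^bsup>-9/8\<^esup> / 8 + E (9 s\<^bsup>-17/8\<^esup> / 16 + s\<^bsup>-9/8\<^esup> (n + p - 2) / (4 (p - 1)))\<close>,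
  which is positive since \<open>E \<ge> 1\<close>. The threshold \<open>\<beta>\<close> enters because \<open>E\<close> may grow up to \<open>s\<close>: the
  correction \<open>s\<^bsup>-9/8\<^esup> E\<close> then stays comparable with \<open>s\<^bsup>-1/8\<^esup>\<close> while still compensating the loss
  from the time derivative of \<open>s\<^bsup>-1/8\<^esup>\<close>. This is the content of
  \<open>strict_classical_supersolution_petrovskii_barrier\<close> and \<open>petrovskii_barrier_bounds\<close>.

  A barrier implies regularity (\<open>regular_boundary_point_if_barrier\<close>). Given \<open>\<epsilon> > 0\<close>, choose \<open>K\<close> such
  that \<open>f 0 - \<epsilon> - K w \<le> f \<le> f 0 + \<epsilon> + K w\<close> at the boundary. The left-hand side is a classical, hence
  a viscosity, subsolution, and so lies below the Perron solution. The right-hand side lies above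
  every competitor \<open>v\<close>: it is a strict supersolution of class \<open>C\<^sup>2\<close>, so it may serve as test
  function at a maximum of the difference, which contradicts the definition of \<open>v\<close> as a viscosity
  subsolution.

  Both steps treat a vanishing gradient together with the general case: the operator applied to a
  test function is always \<open>(1/p) trace X + ((p - 2)/p) X \<nu> \<bullet> \<nu>\<close> for some unit vector \<open>\<nu>\<close>, parallel to
  the gradient if the gradient is nonzero and an extremal eigenvector of \<open>X\<close> otherwise
  (\<open>viscosity_test_iff_directional\<close>). This uses that the Hessian of a \<open>C\<^sup>2\<close> function is symmetric and
  that a symmetric matrix has a real eigenvalue.
\<close>

section \<open>Twice continuously differentiable functions\<close>

lemma C2_on_subset: "C2_on T f \<Longrightarrow> S \<subseteq> T \<Longrightarrow> C2_on S f"
  unfolding C2_on_def by (meson continuous_on_subset subsetD)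

lemma C2_on_imp_continuous_on: "C2_on S f \<Longrightarrow> continuous_on S f"
  unfolding C2_on_def
  by (meson continuous_at_imp_continuous_on has_derivative_continuous)

lemma C2_on_bounded_linear:
  assumes "bounded_linear f"
  shows "C2_on S f"
  unfolding C2_on_def
proof (intro exI conjI ballI)
  fix z assume "z \<in> S"
  show "(f has_derivative blinfun_apply (Blinfun f)) (at z)"
    using assms by (simp add: bounded_linear_Blinfun_apply bounded_linear_imp_has_derivative)
  show "((\<lambda>_. Blinfun f) has_derivative blinfun_apply 0) (at z)"
    by (simp add: zero_blinfun.rep_eq)
qed simp

lemma C2_on_const [simp]: "C2_on S (\<lambda>_. a)"
  unfolding C2_on_def
  by (rule exI[of _ "\<lambda>_. 0"], rule exI[of _ "\<lambda>_. 0"]) (simp add: zero_blinfun.rep_eq)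

lemma C2_on_add:
  assumes "C2_on S f" "C2_on S g"
  shows "C2_on S (\<lambda>z. f z + g z)"
proof -
  obtain f' f'' where f: "\<And>z. z \<in> S \<Longrightarrow> (f has_derivative blinfun_apply (f' z)) (at z)"
    "\<And>z. z \<in> S \<Longrightarrow> (f' has_derivative blinfun_apply (f'' z)) (at z)" "continuous_on S f''"
    using assms(1) unfolding C2_on_def by blast
  obtain g' g'' where g: "\<And>z. z \<in> S \<Longrightarrow> (g has_derivative blinfun_apply (g' z)) (at z)"
    "\<And>z. z \<in> S \<Longrightarrow> (g' has_derivative blinfun_apply (g'' z)) (at z)" "continuous_on S g''"
    using assms(2) unfolding C2_on_def by blast
  show ?thesis unfolding C2_on_def
  proof (intro exI conjI ballI)
    fix z assume z: "z \<in> S"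
    show "((\<lambda>z. f z + g z) has_derivative blinfun_apply (f' z + g' z)) (at z)"
      using has_derivative_add[OF f(1) g(1)] z by (simp add: plus_blinfun.rep_eq)
    show "((\<lambda>z. f' z + g' z) has_derivative blinfun_apply (f'' z + g'' z)) (at z)"
      using has_derivative_add[OF f(2) g(2)] z by (simp add: plus_blinfun.rep_eq)
  next
    show "continuous_on S (\<lambda>z. f'' z + g'' z)"
      using f g by (intro continuous_intros)
  qed
qed

lemma C2_on_sum:
  assumes "finite I" "\<And>i. i \<in> I \<Longrightarrow> C2_on S (f i)"
  shows "C2_on S (\<lambda>z. \<Sum>i\<in>I. f i z)"
  using assms by (induction I rule: finite_induct) (auto intro: C2_on_add)

lemma C2_on_mult:
  fixes f g :: "'a::real_normed_vector \<Rightarrow> real"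
  assumes "C2_on S f" "C2_on S g"
  shows "C2_on S (\<lambda>z. f z * g z)"
proof -
  obtain f' f'' where f: "\<And>z. z \<in> S \<Longrightarrow> (f has_derivative blinfun_apply (f' z)) (at z)"
    "\<And>z. z \<in> S \<Longrightarrow> (f' has_derivative blinfun_apply (f'' z)) (at z)" "continuous_on S f''"
    using assms(1) unfolding C2_on_def by blast
  obtain g' g'' where g: "\<And>z. z \<in> S \<Longrightarrow> (g has_derivative blinfun_apply (g' z)) (at z)"
    "\<And>z. z \<in> S \<Longrightarrow> (g' has_derivative blinfun_apply (g'' z)) (at z)" "continuous_on S g''"
    using assms(2) unfolding C2_on_def by blast
  have cont: "continuous_on S f" "continuous_on S g" "continuous_on S f'" "continuous_on S g'"
    using f g by (meson continuous_at_imp_continuous_on has_derivative_continuous)+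
  let ?H = "\<lambda>z. f z *\<^sub>R g'' z + (blinfun_scaleR_left (g' z) o\<^sub>L f' z)
               + (g z *\<^sub>R f'' z + (blinfun_scaleR_left (f' z) o\<^sub>L g' z))"
  show ?thesis unfolding C2_on_def
  proof (intro exI conjI ballI)
    fix z assume z: "z \<in> S"
    show "((\<lambda>z. f z * g z) has_derivative blinfun_apply (f z *\<^sub>R g' z + g z *\<^sub>R f' z)) (at z)"
      by (rule has_derivative_eq_rhs, rule has_derivative_mult[OF f(1)[OF z] g(1)[OF z]])
         (simp add: fun_eq_iff blinfun.bilinear_simps)
    show "((\<lambda>z. f z *\<^sub>R g' z + g z *\<^sub>R f' z) has_derivative blinfun_apply (?H z)) (at z)"
      by (rule has_derivative_eq_rhs,
          rule has_derivative_add[OF has_derivative_scaleR[OF f(1)[OF z] g(2)[OF z]]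
                                    has_derivative_scaleR[OF g(1)[OF z] f(2)[OF z]]])
         (simp add: fun_eq_iff blinfun.bilinear_simps)
  next
    show "continuous_on S ?H"
      using f g cont by (intro continuous_intros)
  qed
qed

lemma C2_on_compose_real:
  fixes f :: "'a::real_normed_vector \<Rightarrow> real" and h :: "real \<Rightarrow> real"
  assumes "C2_on S f"
    and h1: "\<And>z. z \<in> S \<Longrightarrow> (h has_real_derivative h' (f z)) (at (f z))"
    and h2: "\<And>z. z \<in> S \<Longrightarrow> (h' has_real_derivative h'' (f z)) (at (f z))"
    and h3: "continuous_on (f ` S) h''"
  shows "C2_on S (\<lambda>z. h (f z))"
proof -
  obtain f' f'' where f: "\<And>z. z \<in> S \<Longrightarrow> (f has_derivative blinfun_apply (f' z)) (at z)"
    "\<And>z. z \<in> S \<Longrightarrow> (f' has_derivative blinfun_apply (f'' z)) (at z)" "continuous_on S f''"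
    using assms(1) unfolding C2_on_def by blast
  have cf: "continuous_on S f" "continuous_on S f'"
    using f by (meson continuous_at_imp_continuous_on has_derivative_continuous)+
  have "continuous_on (f ` S) h'"
    using h2 by (auto intro!: continuous_at_imp_continuous_on DERIV_isCont)
  then have ch: "continuous_on S (\<lambda>z. h' (f z))" "continuous_on S (\<lambda>z. h'' (f z))"
    using cf h3 by (auto intro: continuous_on_compose2)
  let ?H = "\<lambda>z. h' (f z) *\<^sub>R f'' z + h'' (f z) *\<^sub>R (blinfun_scaleR_left (f' z) o\<^sub>L f' z)"
  show ?thesis unfolding C2_on_def
  proof (intro exI conjI ballI)
    fix z assume z: "z \<in> S"
    show "((\<lambda>z. h (f z)) has_derivative blinfun_apply (h' (f z) *\<^sub>R f' z)) (at z)"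
      by (rule has_derivative_eq_rhs,
          rule has_derivative_compose[OF f(1)[OF z] h1[OF z, unfolded has_field_derivative_def]])
         (simp add: fun_eq_iff blinfun.bilinear_simps)
    have h'f: "((\<lambda>z. h' (f z)) has_derivative (\<lambda>k. h'' (f z) * f' z k)) (at z)"
      by (rule has_derivative_compose[OF f(1)[OF z] h2[OF z, unfolded has_field_derivative_def]])
    show "((\<lambda>z. h' (f z) *\<^sub>R f' z) has_derivative blinfun_apply (?H z)) (at z)"
      by (rule has_derivative_eq_rhs, rule has_derivative_scaleR[OF h'f f(2)[OF z]])
         (simp add: fun_eq_iff blinfun.bilinear_simps)
  next
    show "continuous_on S ?H"
      using f cf ch by (intro continuous_intros)
  qed
qed

section \<open>Symmetry of second derivatives\<close>

text \<open>
  The second difference in the directions \<open>h\<close> and \<open>k\<close> is the increment over \<open>[0, 1]\<close> of a function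
  of one variable whose derivative is a difference of two values of \<open>f'\<close>. After the
  mean value theorem only the differentiability of \<open>f'\<close> at the single point \<open>z\<close> enters.
\<close>

lemma second_difference_approx:
  fixes f :: "'a::real_normed_vector \<Rightarrow> real" and B :: "'a \<Rightarrow>\<^sub>L ('a \<Rightarrow>\<^sub>L real)"
  assumes der: "\<And>y. norm y < d \<Longrightarrow> (f has_derivative blinfun_apply (f' (z + y))) (at (z + y))"
    and approx: "\<And>y. norm y < d \<Longrightarrow> norm (f' (z + y) - f' z - blinfun_apply B y) \<le> e * norm y"
    and small: "norm h + norm k < d" and "0 \<le> e"
  shows "\<bar>(f (z + h + k) - f (z + h) - f (z + k) + f z) - blinfun_apply (blinfun_apply B k) h\<bar>
           \<le> 2 * e * (norm h + norm k)^2"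
proof -
  define g where "g s = f (z + (s *\<^sub>R h + k)) - f (z + s *\<^sub>R h)" for s :: real
  define g' where "g' s = f' (z + (s *\<^sub>R h + k)) h - f' (z + s *\<^sub>R h) h" for s :: real
  have n: "norm (s *\<^sub>R h) \<le> norm h" "norm (s *\<^sub>R h + k) \<le> norm h + norm k"
    if "0 \<le> s" "s \<le> 1" for s
  proof -
    show *: "norm (s *\<^sub>R h) \<le> norm h" using that by (simp add: mult_left_le_one_le)
    show "norm (s *\<^sub>R h + k) \<le> norm h + norm k"
      using norm_triangle_ineq[of "s *\<^sub>R h" k] * by linarith
  qed
  have ds: "norm (s *\<^sub>R h) < d" "norm (s *\<^sub>R h + k) < d" if "0 \<le> s" "s \<le> 1" for s
    using n[OF that] small norm_ge_zero[of k] by linarith+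
  have "(g has_real_derivative g' s) (at s)" if "0 \<le> s" "s \<le> 1" for s
  proof -
    have a: "((\<lambda>s. z + (s *\<^sub>R h + k)) has_derivative (\<lambda>r. r *\<^sub>R h)) (at s)"
      by (auto intro!: derivative_eq_intros)
    have b: "((\<lambda>s. z + s *\<^sub>R h) has_derivative (\<lambda>r. r *\<^sub>R h)) (at s)"
      by (auto intro!: derivative_eq_intros)
    show ?thesis
      unfolding g_def g'_def has_field_derivative_def
      by (rule has_derivative_eq_rhs, rule has_derivative_diff[OF
            has_derivative_compose[OF a der[OF ds(2)[OF that]]]
            has_derivative_compose[OF b der[OF ds(1)[OF that]]]])
         (auto simp: blinfun.bilinear_simps algebra_simps)
  qed
  then obtain s where s: "0 < s" "s < 1" and mvt: "g 1 - g 0 = g' s"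
    using MVT2[of 0 1 g g'] by auto
  define A1 where "A1 = f' (z + (s *\<^sub>R h + k)) - f' z - B (s *\<^sub>R h + k)"
  define A2 where "A2 = f' (z + s *\<^sub>R h) - f' z - B (s *\<^sub>R h)"
  have N: "norm A1 \<le> e * (norm h + norm k)" "norm A2 \<le> e * (norm h + norm k)"
  proof -
    have "norm A1 \<le> e * norm (s *\<^sub>R h + k)" "norm A2 \<le> e * norm (s *\<^sub>R h)"
      unfolding A1_def A2_def using s by (intro approx ds; simp)+
    moreover have "norm (s *\<^sub>R h + k) \<le> norm h + norm k" "norm (s *\<^sub>R h) \<le> norm h + norm k"
      using n[of s] s norm_ge_zero[of k] by linarith+
    ultimately show "norm A1 \<le> e * (norm h + norm k)" "norm A2 \<le> e * (norm h + norm k)"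
      using \<open>0 \<le> e\<close> by (meson mult_left_mono order_trans)+
  qed
  have "g' s - B k h = (A1 - A2) h"
    unfolding g'_def A1_def A2_def by (simp add: blinfun.bilinear_simps)
  then have "\<bar>g' s - B k h\<bar> \<le> norm (A1 - A2) * norm h"
    using norm_blinfun[of "A1 - A2" h] by simp
  also have "\<dots> \<le> (norm A1 + norm A2) * norm h"
    by (simp add: mult_right_mono norm_triangle_ineq4)
  also have "\<dots> \<le> (2 * e * (norm h + norm k)) * (norm h + norm k)"
    using N \<open>0 \<le> e\<close> by (intro mult_mono) auto
  finally have "\<bar>(g 1 - g 0) - B k h\<bar> \<le> 2 * e * (norm h + norm k)^2"
    by (simp add: mvt power2_eq_square algebra_simps)
  then show ?thesis by (simp add: g_def algebra_simps)
qed

text \<open>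
  The second difference is symmetric in \<open>h\<close> and \<open>k\<close>, and it approximates both \<open>B k h\<close> and
  \<open>B h k\<close> up to \<open>o(t\<^sup>2)\<close> after both directions are scaled by \<open>t\<close>.
\<close>

lemma second_derivative_symmetric:
  fixes f :: "'a::real_normed_vector \<Rightarrow> real"
  assumes S: "open S" "z \<in> S"
    and der: "\<And>y. y \<in> S \<Longrightarrow> (f has_derivative blinfun_apply (f' y)) (at y)"
    and der2: "(f' has_derivative blinfun_apply B) (at z)"
  shows "blinfun_apply (blinfun_apply B h) k = blinfun_apply (blinfun_apply B k) h"
proof -
  define N where "N = norm h + norm k"
  have bound: "\<bar>B h k - B k h\<bar> \<le> 4 * e * N^2" if e: "0 < e" for e
  proof -
    obtain d1 where d1: "0 < d1" "ball z d1 \<subseteq> S"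
      using S openE by blast
    obtain d2 where d2: "0 < d2"
      "\<And>y. norm (y - z) < d2 \<Longrightarrow> norm (f' y - f' z - B (y - z)) \<le> e * norm (y - z)"
      using der2 e unfolding has_derivative_at_alt by blast
    define d where "d = min d1 d2"
    have d: "0 < d" using d1 d2 by (simp add: d_def)
    \<comment> \<open>Scaling both directions by \<open>t\<close> brings them into the ball where \<open>f'\<close> is nearly affine.\<close>
    define t where "t = d / (2 * (N + 1))"
    have N0: "0 \<le> N" by (simp add: N_def)
    have t: "0 < t" using d N0 by (simp add: t_def)
    have "t * N < d"
    proof -
      have "t * N = d * (N / (2 * (N + 1)))" by (simp add: t_def)
      also have "\<dots> < d * 1" using d N0 by (intro mult_strict_left_mono) (auto simp: field_simps)
      finally show ?thesis by simp
    qed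
    then have small: "norm (t *\<^sub>R h) + norm (t *\<^sub>R k) < d"
      using t by (simp add: N_def algebra_simps)
    have D: "(f has_derivative blinfun_apply (f' (z + y))) (at (z + y))" if "norm y < d" for y
    proof -
      have "z + y \<in> ball z d1" using that by (simp add: d_def dist_norm)
      then show ?thesis using der d1 by blast
    qed
    have P: "norm (f' (z + y) - f' z - blinfun_apply B y) \<le> e * norm y" if "norm y < d" for y
      using d2(2)[of "z + y"] that by (simp add: d_def)
    have tN: "norm (t *\<^sub>R h) + norm (t *\<^sub>R k) = t * N"
      using t by (simp add: N_def algebra_simps)
    have "\<bar>B (t *\<^sub>R h) (t *\<^sub>R k) - B (t *\<^sub>R k) (t *\<^sub>R h)\<bar> \<le> 4 * e * (t * N)^2"
    proof -
      have tN': "norm (t *\<^sub>R k) + norm (t *\<^sub>R h) = t * N" using tN by simp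
      have 1: "\<bar>(f (z + t *\<^sub>R h + t *\<^sub>R k) - f (z + t *\<^sub>R h) - f (z + t *\<^sub>R k) + f z)
                - B (t *\<^sub>R k) (t *\<^sub>R h)\<bar> \<le> 2 * e * (t * N)^2"
        using second_difference_approx[OF D P small, unfolded tN] e by simp
      have 2: "\<bar>(f (z + t *\<^sub>R k + t *\<^sub>R h) - f (z + t *\<^sub>R k) - f (z + t *\<^sub>R h) + f z)
                - B (t *\<^sub>R h) (t *\<^sub>R k)\<bar> \<le> 2 * e * (t * N)^2"
        using second_difference_approx[OF D P, where h = "t *\<^sub>R k" and k = "t *\<^sub>R h",
            unfolded tN'] small[unfolded tN] e by simp
      have 3: "z + t *\<^sub>R k + t *\<^sub>R h = z + t *\<^sub>R h + t *\<^sub>R k" by simp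
      from 1 2 show ?thesis unfolding 3 by linarith
    qed
    moreover have "B (t *\<^sub>R h) (t *\<^sub>R k) - B (t *\<^sub>R k) (t *\<^sub>R h) = t^2 * (B h k - B k h)"
      by (simp add: blinfun.bilinear_simps power2_eq_square algebra_simps)
    ultimately have "t^2 * \<bar>B h k - B k h\<bar> \<le> t^2 * (4 * e * N^2)"
      by (simp add: abs_mult power_mult_distrib mult_ac)
    then show ?thesis using t by simp
  qed
  have "\<bar>B h k - B k h\<bar> \<le> 0"
  proof (rule field_le_epsilon)
    fix e :: real assume e: "0 < e"
    define M where "M = N^2 + 1"
    have M: "N^2 \<le> M" "0 < M" by (simp_all add: M_def add_nonneg_pos)
    have "4 * (e / (4 * M)) * N^2 = e * N^2 / M" by simp
    also have "\<dots> \<le> e * M / M" using e M by (intro divide_right_mono mult_left_mono) auto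
    also have "\<dots> = e" using M by simp
    finally show "\<bar>B h k - B k h\<bar> \<le> 0 + e"
      using bound[of "e / (4 * M)"] e M by simp
  qed
  then show ?thesis by simp
qed

section \<open>Spatial and time derivatives\<close>

lemma has_derivative_vec_componentwise:
  fixes f :: "'a::real_normed_vector \<Rightarrow> real ^ 'n"
  assumes "\<And>i. ((\<lambda>y. f y $ i) has_derivative (\<lambda>h. f' h $ i)) (at x)"
  shows "(f has_derivative f') (at x)"
  using assms
  by (subst has_derivative_componentwise_within) (auto simp: Basis_vec_def inner_axis)

lemma linear_functional_eq_inner:
  fixes f :: "real ^ 'n \<Rightarrow> real"
  assumes "linear f"
  shows "f h = (\<chi> i. f (axis i 1)) \<bullet> h"
proof -
  have "f h = f (\<Sum>i\<in>UNIV. (h $ i) *\<^sub>R axis i 1)"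
    using basis_expansion[of h] by (simp add: scalar_mult_eq_scaleR)
  also have "\<dots> = (\<Sum>i\<in>UNIV. h $ i * f (axis i 1))"
    by (simp add: linear_sum[OF assms] linear_cmul[OF assms])
  finally show ?thesis by (simp add: inner_vec_def mult.commute)
qed

lemma spatial_gradient_eqI:
  assumes "((\<lambda>y. u (y, t)) has_derivative (\<lambda>h. q \<bullet> h)) (at x)"
  shows "spatial_gradient u (x, t) = q"
  using frechet_derivative_at[OF assms, symmetric]
  by (simp add: spatial_gradient_def vec_eq_iff inner_axis)

lemma spatial_hessian_eqI:
  assumes "((\<lambda>y. spatial_gradient u (y, t)) has_derivative (\<lambda>h. X *v h)) (at x)"
  shows "spatial_hessian u (x, t) = X"
  using frechet_derivative_at[OF assms, symmetric]
  by (simp add: spatial_hessian_def jacobian_def)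

lemma time_derivative_eqI:
  assumes "((\<lambda>s. u (x, s)) has_real_derivative d) (at t)"
  shows "time_derivative u (x, t) = d"
  using DERIV_imp_deriv[OF assms] by (simp add: time_derivative_def)

lemma open_time_slice: "open \<Omega> \<Longrightarrow> open {y. (y, t) \<in> \<Omega>}"
  using open_vimage[of \<Omega> "\<lambda>y. (y, t)"] continuous_on_Pair[OF continuous_on_id continuous_on_const]
  by (auto simp: vimage_def)

text \<open>
  Joint regularity in space-time turns the derivatives that are defined through partial derivatives
  into honest Frechet derivatives in space, with a symmetric Hessian. Symmetry is what makes the
  extreme eigenvalues in the notion of viscosity solution meaningful.
\<close>

lemma C2_on_spatial_derivatives:
  fixes u :: "(real ^ 'n) \<times> real \<Rightarrow> real"
  assumes C2: "C2_on \<Omega> u" and \<Omega>: "open \<Omega>" and z: "(x, t) \<in> \<Omega>"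
  shows "((\<lambda>y. u (y, t)) has_derivative (\<lambda>h. spatial_gradient u (x, t) \<bullet> h)) (at x)"
    and "((\<lambda>y. spatial_gradient u (y, t)) has_derivative (\<lambda>h. spatial_hessian u (x, t) *v h)) (at x)"
    and "((\<lambda>s. u (x, s)) has_real_derivative time_derivative u (x, t)) (at t)"
    and "transpose (spatial_hessian u (x, t)) = spatial_hessian u (x, t)"
proof -
  obtain u' u'' where u': "\<And>z. z \<in> \<Omega> \<Longrightarrow> (u has_derivative blinfun_apply (u' z)) (at z)"
    and u'': "\<And>z. z \<in> \<Omega> \<Longrightarrow> (u' has_derivative blinfun_apply (u'' z)) (at z)"
    using C2 unfolding C2_on_def by blast
  have slice: "((\<lambda>y. (y, s)) has_derivative (\<lambda>h. (h, 0))) (at y)" for y :: "real ^ 'n" and s :: real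
    by (auto intro!: derivative_eq_intros)
  define q where "q y = (\<chi> i. u' (y, t) (axis i 1, 0))" for y
  have q_der: "((\<lambda>y. u (y, t)) has_derivative (\<lambda>h. q y \<bullet> h)) (at y)" if "(y, t) \<in> \<Omega>" for y
  proof (rule has_derivative_eq_rhs)
    show "((\<lambda>y. u (y, t)) has_derivative (\<lambda>h. u' (y, t) (h, 0))) (at y)"
      by (rule has_derivative_compose[OF slice u'[OF that]])
    have "linear (\<lambda>h. u' (y, t) (h, 0))"
      by (rule has_derivative_linear[OF has_derivative_compose[OF slice u'[OF that]]])
    from linear_functional_eq_inner[OF this]
    show "(\<lambda>h. u' (y, t) (h, 0)) = (\<lambda>h. q y \<bullet> h)"
      unfolding q_def by blast
  qed
  have grad: "spatial_gradient u (y, t) = q y" if "(y, t) \<in> \<Omega>" for y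
    by (rule spatial_gradient_eqI[OF q_der[OF that]])
  show "((\<lambda>y. u (y, t)) has_derivative (\<lambda>h. spatial_gradient u (x, t) \<bullet> h)) (at x)"
    using q_der[OF z] grad[OF z] by simp
  define X where "X = (\<chi> i j. u'' (x, t) (axis j 1, 0) (axis i 1, 0))"
  have "((\<lambda>y. q y) has_derivative (\<lambda>h. X *v h)) (at x)"
  proof (rule has_derivative_vec_componentwise)
    fix i
    have b: "bounded_linear (\<lambda>T::((real ^ 'n) \<times> real) \<Rightarrow>\<^sub>L real. T (axis i 1, 0))"
      by (rule blinfun.bounded_linear_left)
    have d: "((\<lambda>y. u' (y, t) (axis i 1, 0)) has_derivative (\<lambda>h. u'' (x, t) (h, 0) (axis i 1, 0))) (at x)"
      by (rule bounded_linear.has_derivative[OF b has_derivative_compose[OF slice u''[OF z]]])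
    have "(\<lambda>h. u'' (x, t) (h, 0) (axis i 1, 0)) = (\<lambda>h. (X *v h) $ i)"
    proof (rule ext)
      fix h
      show "u'' (x, t) (h, 0) (axis i 1, 0) = (X *v h) $ i"
        unfolding X_def matrix_vector_mul_component vec_lambda_beta
        by (rule linear_functional_eq_inner[OF has_derivative_linear[OF d]])
    qed
    with d show "((\<lambda>y. q y $ i) has_derivative (\<lambda>h. (X *v h) $ i)) (at x)"
      by (simp add: q_def)
  qed
  then have hess_der: "((\<lambda>y. spatial_gradient u (y, t)) has_derivative (\<lambda>h. X *v h)) (at x)"
    by (rule has_derivative_transform_within_open[OF _ open_time_slice[OF \<Omega>]]) (use z grad in auto)
  then have X: "spatial_hessian u (x, t) = X"
    by (rule spatial_hessian_eqI)
  show "((\<lambda>y. spatial_gradient u (y, t)) has_derivative (\<lambda>h. spatial_hessian u (x, t) *v h)) (at x)"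
    using hess_der X by simp
  show "transpose (spatial_hessian u (x, t)) = spatial_hessian u (x, t)"
    unfolding X X_def transpose_def
    by (simp add: vec_eq_iff second_derivative_symmetric[OF \<Omega> z u' u''[OF z]])
  have time_line: "((\<lambda>s. (x, s)) has_derivative (\<lambda>h. (0, h))) (at t)"
    by (auto intro!: derivative_eq_intros)
  have "((\<lambda>s. u (x, s)) has_derivative (\<lambda>h. u' (x, t) (0, h))) (at t)"
    by (rule has_derivative_compose[OF time_line u'[OF z]])
  then have "(\<lambda>s. u (x, s)) differentiable (at t)"
    by (rule differentiableI)
  then show "((\<lambda>s. u (x, s)) has_real_derivative time_derivative u (x, t)) (at t)"
    unfolding time_derivative_def by (simp add: DERIV_deriv_iff_real_differentiable)
qed

lemma
  fixes u :: "(real ^ 'n) \<times> real \<Rightarrow> real"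
  assumes C2: "C2_on \<Omega> u" and \<Omega>: "open \<Omega>" and z: "z \<in> \<Omega>"
  shows spatial_gradient_affine: "spatial_gradient (\<lambda>z. a + b * u z) z = b *\<^sub>R spatial_gradient u z"
    and spatial_hessian_affine: "spatial_hessian (\<lambda>z. a + b * u z) z = b *\<^sub>R spatial_hessian u z"
    and time_derivative_affine: "time_derivative (\<lambda>z. a + b * u z) z = b * time_derivative u z"
proof -
  have grad: "spatial_gradient (\<lambda>z. a + b * u z) z = b *\<^sub>R spatial_gradient u z" if "z \<in> \<Omega>" for z
  proof -
    obtain x t where xt: "z = (x, t)" by (cases z)
    have "((\<lambda>y. a + b * u (y, t)) has_derivative (\<lambda>h. b *\<^sub>R spatial_gradient u (x, t) \<bullet> h)) (at x)"
      using C2_on_spatial_derivatives(1)[OF C2 \<Omega>, of x t] that xt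
      by (auto intro!: derivative_eq_intros)
    then show ?thesis unfolding xt by (rule spatial_gradient_eqI)
  qed
  obtain x t where xt: "z = (x, t)" by (cases z)
  note D = C2_on_spatial_derivatives[OF C2 \<Omega> z[unfolded xt]]
  show "spatial_gradient (\<lambda>z. a + b * u z) z = b *\<^sub>R spatial_gradient u z"
    by (rule grad[OF z])
  have "((\<lambda>y. b *\<^sub>R spatial_gradient u (y, t)) has_derivative (\<lambda>h. (b *\<^sub>R spatial_hessian u (x, t)) *v h)) (at x)"
    using has_derivative_scaleR_right[OF D(2)] by (simp add: scaleR_matrix_vector_assoc)
  then have "((\<lambda>y. spatial_gradient (\<lambda>z. a + b * u z) (y, t)) has_derivative
      (\<lambda>h. (b *\<^sub>R spatial_hessian u (x, t)) *v h)) (at x)"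
    by (rule has_derivative_transform_within_open[OF _ open_time_slice[OF \<Omega>]]) (use z grad xt in auto)
  then show "spatial_hessian (\<lambda>z. a + b * u z) z = b *\<^sub>R spatial_hessian u z"
    unfolding xt by (rule spatial_hessian_eqI)
  show "time_derivative (\<lambda>z. a + b * u z) z = b * time_derivative u z"
    unfolding xt
    by (rule time_derivative_eqI) (use D(3) in \<open>auto intro!: derivative_eq_intros\<close>)
qed

section \<open>Derivatives at a point of contact\<close>

lemma second_derivative_nonneg_at_min:
  fixes g :: "real \<Rightarrow> real"
  assumes e: "0 < e"
    and g: "\<And>s. \<bar>s\<bar> < e \<Longrightarrow> (g has_real_derivative g' s) (at s)"
    and g': "(g' has_real_derivative D) (at 0)"
    and min: "\<And>s. \<bar>s\<bar> < e \<Longrightarrow> g 0 \<le> g s"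
  shows "g' 0 = 0" and "0 \<le> D"
proof -
  show g'0: "g' 0 = 0"
    using DERIV_local_min[OF g[of 0] e] min e by auto
  show "0 \<le> D"
  proof (rule ccontr)
    assume "\<not> 0 \<le> D"
    then obtain d where d: "0 < d" "\<And>h. 0 < h \<Longrightarrow> h < d \<Longrightarrow> g' h < 0"
      using DERIV_neg_dec_right[OF g'] g'0 by auto
    define h where "h = min d e / 2"
    have h: "0 < h" "h < d" "h < e" using d e by (auto simp: h_def)
    obtain r where r: "0 < r" "r < h" "g h - g 0 = (h - 0) * g' r"
      using MVT2[of 0 h g g'] g h by (smt (verit))
    have "g h - g 0 < 0" using r d(2)[of r] h by (simp add: mult_pos_neg)
    then show False using min[of h] h by simp
  qed
qed

text \<open>
  Along each spatial line through \<open>z\<close> the function \<open>\<phi> - u\<close> has a local minimum, so the difference of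
  the Hessians is a nonnegative quadratic form.
\<close>

lemma derivatives_at_interior_max:
  fixes u \<phi> :: "(real ^ 'n) \<times> real \<Rightarrow> real"
  assumes \<Omega>: "open \<Omega>" and u: "C2_on \<Omega> u" and \<phi>: "C2_on \<Omega> \<phi>" and z: "z \<in> \<Omega>"
    and max: "\<And>w. w \<in> \<Omega> \<Longrightarrow> u w - \<phi> w \<le> u z - \<phi> z"
  shows "spatial_gradient \<phi> z = spatial_gradient u z"
    and "time_derivative \<phi> z = time_derivative u z"
    and "(spatial_hessian u z *v v) \<bullet> v \<le> (spatial_hessian \<phi> z *v v) \<bullet> v"
proof -
  obtain x t where xt: "z = (x, t)" by (cases z)
  obtain r where r: "0 < r" "ball z r \<subseteq> \<Omega>" using \<Omega> z openE by blast
  note Du = C2_on_spatial_derivatives[OF u \<Omega>] and D\<phi> = C2_on_spatial_derivatives[OF \<phi> \<Omega>]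
  have spatial: "(spatial_gradient \<phi> z - spatial_gradient u z) \<bullet> v = 0 \<and>
      0 \<le> ((spatial_hessian \<phi> z - spatial_hessian u z) *v v) \<bullet> v" for v
  proof -
    define e where "e = r / (norm v + 1)"
    have e: "0 < e" using r by (simp add: e_def add_nonneg_pos)
    have inside: "(x + s *\<^sub>R v, t) \<in> \<Omega>" if "\<bar>s\<bar> < e" for s
    proof -
      have "\<bar>s\<bar> * (norm v + 1) < r"
        using that by (simp add: e_def pos_less_divide_eq add_nonneg_pos)
      then have "\<bar>s\<bar> * norm v < r" by (simp add: algebra_simps)
      then show ?thesis using r xt by (auto simp: dist_Pair_Pair dist_norm subset_iff)
    qed
    have line: "((\<lambda>s. x + s *\<^sub>R v) has_derivative (\<lambda>h. h *\<^sub>R v)) (at s)" for s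
      by (auto intro!: derivative_eq_intros)
    define g where "g s = \<phi> (x + s *\<^sub>R v, t) - u (x + s *\<^sub>R v, t)" for s
    define g' where "g' s = (spatial_gradient \<phi> (x + s *\<^sub>R v, t)
        - spatial_gradient u (x + s *\<^sub>R v, t)) \<bullet> v" for s
    have 1: "(g has_real_derivative g' s) (at s)" if "\<bar>s\<bar> < e" for s
      unfolding g_def g'_def has_field_derivative_def
      by (rule has_derivative_eq_rhs, rule has_derivative_diff[OF
            has_derivative_compose[OF line D\<phi>(1)[OF inside[OF that]]]
            has_derivative_compose[OF line Du(1)[OF inside[OF that]]]])
         (auto simp: fun_eq_iff inner_diff_left algebra_simps)
    have in0: "(x + 0 *\<^sub>R v, t) \<in> \<Omega>" using z xt by simp
    have 2: "(g' has_real_derivative ((spatial_hessian \<phi> z - spatial_hessian u z) *v v) \<bullet> v) (at 0)"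
      unfolding g'_def has_field_derivative_def
      by (rule has_derivative_eq_rhs, rule has_derivative_inner_left, rule has_derivative_diff[OF
            has_derivative_compose[OF line D\<phi>(2)[OF in0]]
            has_derivative_compose[OF line Du(2)[OF in0]]])
         (auto simp: fun_eq_iff xt inner_diff_left matrix_vector_mult_diff_rdistrib
            matrix_vector_mult_scaleR algebra_simps)
    have 3: "g 0 \<le> g s" if "\<bar>s\<bar> < e" for s
      using max[OF inside[OF that]] xt by (simp add: g_def)
    show ?thesis
      using second_derivative_nonneg_at_min[OF e 1 2 3] xt by (simp add: g'_def)
  qed
  show "spatial_gradient \<phi> z = spatial_gradient u z"
    using spatial by (metis inner_eq_zero_iff right_minus_eq)
  show "(spatial_hessian u z *v v) \<bullet> v \<le> (spatial_hessian \<phi> z *v v) \<bullet> v"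
    using spatial[of v] by (simp add: matrix_vector_mult_diff_rdistrib inner_diff_left)
  have "((\<lambda>s. u (x, s) - \<phi> (x, s)) has_real_derivative
      time_derivative u (x, t) - time_derivative \<phi> (x, t)) (at t)"
    using Du(3) D\<phi>(3) z xt by (auto intro!: derivative_intros)
  then have "time_derivative u (x, t) - time_derivative \<phi> (x, t) = 0"
  proof (rule DERIV_local_max[OF _ r(1)], intro allI impI)
    fix s assume "\<bar>t - s\<bar> < r"
    then have "(x, s) \<in> \<Omega>" using r xt by (auto simp: dist_Pair_Pair dist_norm subset_iff)
    then show "u (x, s) - \<phi> (x, s) \<le> u (x, t) - \<phi> (x, t)" using max xt by blast
  qed
  then show "time_derivative \<phi> z = time_derivative u z" using xt by simp
qed

section \<open>Quadratic forms\<close>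

lemma symmetric_matrix_inner:
  fixes X :: "real ^ 'n ^ 'n"
  assumes "transpose X = X"
  shows "(X *v v) \<bullet> w = v \<bullet> (X *v w)"
  using assms by (metis dot_lmul_matrix vector_transpose_matrix)

text \<open>
  A vector on which a nonnegative form vanishes minimises the form, so the derivative of the form at
  this vector vanishes in every direction.
\<close>

lemma kernel_of_semidefinite:
  fixes X :: "real ^ 'n ^ 'n"
  assumes sym: "transpose X = X" and psd: "\<And>v. 0 \<le> (X *v v) \<bullet> v" and e: "(X *v e) \<bullet> e = 0"
  shows "X *v e = 0"
proof -
  have "(X *v e) \<bullet> w = 0" for w
  proof -
    have expand: "0 \<le> 2 * s * ((X *v e) \<bullet> w) + s^2 * ((X *v w) \<bullet> w)" for s
      using psd[of "e + s *\<^sub>R w"] e symmetric_matrix_inner[OF sym, of w e]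
      by (simp add: matrix_vector_right_distrib matrix_vector_mult_scaleR inner_add_left
          inner_add_right power2_eq_square algebra_simps inner_commute)
    define g where "g s = 2 * s * ((X *v e) \<bullet> w) + s^2 * ((X *v w) \<bullet> w)" for s
    have D: "(g has_real_derivative 2 * ((X *v e) \<bullet> w)) (at 0)"
      unfolding g_def by (auto intro!: derivative_eq_intros)
    have "\<forall>s. \<bar>0 - s\<bar> < 1 \<longrightarrow> g 0 \<le> g s" using expand by (simp add: g_def)
    with DERIV_local_min[OF D, of 1] show ?thesis by simp
  qed
  then show ?thesis by (metis inner_eq_zero_iff)
qed

text \<open>
  A maximiser \<open>e\<close> of the Rayleigh quotient, with maximum \<open>m\<close>, lies in the kernel of the nonnegative
  form \<open>m I - X\<close>.
\<close>

lemma symmetric_matrix_has_eigenvalue: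
  fixes X :: "real ^ 'n ^ 'n"
  assumes sym: "transpose X = X"
  shows "real_eigenvalues X \<noteq> {}"
proof -
  have "compact (sphere (0 :: real ^ 'n) 1)" "sphere (0 :: real ^ 'n) 1 \<noteq> {}" by auto
  moreover have "continuous_on (sphere 0 1) (\<lambda>v. (X *v v) \<bullet> v)"
    by (intro continuous_intros linear_continuous_on linear_linear[THEN iffD1] matrix_vector_mul_linear)
  ultimately obtain e where e: "norm e = 1"
    and max: "\<And>v. norm v = 1 \<Longrightarrow> (X *v v) \<bullet> v \<le> (X *v e) \<bullet> e"
    using continuous_attains_sup[of "sphere 0 1" "\<lambda>v. (X *v v) \<bullet> v"] by auto
  define m where "m = (X *v e) \<bullet> e"
  \<comment> \<open>The form \<open>m I - X\<close> is nonnegative by homogeneity and vanishes at \<open>e\<close>.\<close>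
  define Y where "Y = m *\<^sub>R mat 1 - X"
  have Yv: "Y *v v = m *\<^sub>R v - X *v v" for v
    by (simp add: Y_def matrix_vector_mult_diff_rdistrib flip: scaleR_matrix_vector_assoc)
  have "transpose Y = Y"
    using sym by (simp add: Y_def transpose_def vec_eq_iff mat_def)
  moreover have "0 \<le> (Y *v v) \<bullet> v" for v
  proof (cases "v = 0")
    case False
    have "(X *v (v /\<^sub>R norm v)) \<bullet> (v /\<^sub>R norm v) \<le> m"
      unfolding m_def using False by (intro max) simp
    then have "(X *v v) \<bullet> v / (norm v)^2 \<le> m"
      by (simp add: matrix_vector_mult_scaleR power2_eq_square field_simps)
    then have "(X *v v) \<bullet> v \<le> m * (norm v)^2"
      using False by (simp add: field_simps)
    then show ?thesis by (simp add: Yv inner_diff_left power2_norm_eq_inner)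
  qed simp
  moreover have "(Y *v e) \<bullet> e = 0"
    using e by (simp add: Yv inner_diff_left m_def norm_eq_1)
  ultimately have "Y *v e = 0" by (rule kernel_of_semidefinite)
  then have "X *v e = m *\<^sub>R e" by (simp add: Yv)
  moreover have "e \<noteq> 0" using e by auto
  ultimately show ?thesis unfolding real_eigenvalues_def by blast
qed

text \<open>
  Eigenvectors for different eigenvalues are orthogonal, and a Euclidean space contains only finite
  orthogonal families of nonzero vectors.
\<close>

lemma finite_real_eigenvalues:
  fixes X :: "real ^ 'n ^ 'n"
  assumes sym: "transpose X = X"
  shows "finite (real_eigenvalues X)"
proof -
  define e where "e l = (SOME v. v \<noteq> 0 \<and> X *v v = l *\<^sub>R v)" for l
  have e: "e l \<noteq> 0" "X *v e l = l *\<^sub>R e l" if "l \<in> real_eigenvalues X" for l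
    using that someI_ex[of "\<lambda>v. v \<noteq> 0 \<and> X *v v = l *\<^sub>R v"]
    unfolding real_eigenvalues_def e_def by auto
  have orth: "e k \<bullet> e l = 0" if "k \<in> real_eigenvalues X" "l \<in> real_eigenvalues X" "k \<noteq> l" for k l
    using symmetric_matrix_inner[OF sym, of "e k" "e l"] e that by auto
  then have "pairwise orthogonal (e ` real_eigenvalues X)"
    by (auto simp: pairwise_def orthogonal_def)
  then have "finite (e ` real_eigenvalues X)" by (rule pairwise_orthogonal_imp_finite)
  moreover have "inj_on e (real_eigenvalues X)"
    by (rule inj_onI) (metis e(1) inner_eq_zero_iff orth)
  ultimately show ?thesis by (rule finite_imageD)
qed

lemma unit_eigenvector:
  assumes "l \<in> real_eigenvalues X"
  obtains e where "norm e = 1" "(X *v e) \<bullet> e = l"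
proof -
  obtain v where v: "v \<noteq> 0" "X *v v = l *\<^sub>R v"
    using assms unfolding real_eigenvalues_def by blast
  define e where "e = v /\<^sub>R norm v"
  have "norm e = 1" using v by (simp add: e_def)
  moreover have "X *v e = l *\<^sub>R e" using v by (simp add: e_def matrix_vector_mult_scaleR)
  ultimately show ?thesis using that[of e] by (simp add: norm_eq_1)
qed

text \<open>
  The trace is the sum of the values of the form on any orthonormal basis; choose one that
  contains \<open>\<nu>\<close>.
\<close>

lemma trace_ge_quadratic_form:
  fixes M :: "real ^ 'n ^ 'n"
  assumes psd: "\<And>v. 0 \<le> (M *v v) \<bullet> v" and \<nu>: "norm \<nu> = 1"
  shows "(M *v \<nu>) \<bullet> \<nu> \<le> trace M"
proof -
  obtain Q k where Q: "orthogonal_matrix Q" "Q *v (axis k 1) = \<nu>"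
    using orthogonal_matrix_exists_basis[OF \<nu>] by metis
  have entry: "(transpose Q ** (M ** Q)) $ i $ i = (M *v (Q *v axis i 1)) \<bullet> (Q *v axis i 1)" for i
  proof -
    have "(transpose Q ** (M ** Q)) $ i $ i = ((transpose Q ** (M ** Q)) *v axis i 1) \<bullet> axis i 1"
      by (simp only: inner_axis matrix_vector_mul_component inner_real_def mult_1_right)
    also have "\<dots> = (transpose Q *v (M *v (Q *v axis i 1))) \<bullet> axis i 1"
      by (simp only: matrix_vector_mul_assoc)
    also have "\<dots> = (M *v (Q *v axis i 1)) \<bullet> (Q *v axis i 1)"
      by (metis dot_lmul_matrix vector_transpose_matrix transpose_matrix_vector)
    finally show ?thesis .
  qed
  have "trace M = trace (M ** (Q ** transpose Q))"
    using Q by (simp add: orthogonal_matrix_def)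
  also have "\<dots> = trace (transpose Q ** (M ** Q))"
    using trace_mul_sym[of "M ** Q" "transpose Q"] by (simp add: matrix_mul_assoc)
  also have "\<dots> = (\<Sum>i\<in>UNIV. (M *v (Q *v axis i 1)) \<bullet> (Q *v axis i 1))"
    by (simp add: trace_def entry)
  also have "\<dots> \<ge> (M *v (Q *v axis k 1)) \<bullet> (Q *v axis k 1)"
    by (rule member_le_sum) (auto simp: psd)
  finally show ?thesis using Q by simp
qed

section \<open>Classical supersolutions and viscosity subsolutions\<close>

text \<open>
  The normalised \<open>p\<close>-Laplacian with the direction of the gradient replaced by an arbitrary unit
  vector. The operator at a vanishing gradient is of this form too, with an extremal eigenvector as
  direction, so that the cases \<open>Du \<noteq> 0\<close> and \<open>Du = 0\<close>, \<open>p \<ge> 2\<close> and \<open>p < 2\<close> can be treated alike.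
\<close>

definition directional_p_laplacian :: "real \<Rightarrow> real ^ 'n ^ 'n \<Rightarrow> real ^ 'n \<Rightarrow> real" where
  "directional_p_laplacian p X \<nu> = 1 / p * trace X + (p - 2) / p * ((X *v \<nu>) \<bullet> \<nu>)"

text \<open>
  Where the gradient vanishes, the inequality is imposed in every direction \<open>\<nu>\<close>; elsewhere the
  condition on \<open>\<nu>\<close> leaves only the two unit vectors parallel to the gradient.
\<close>

definition strict_classical_supersolution ::
    "real \<Rightarrow> ((real ^ 'n) \<times> real) set \<Rightarrow> ((real ^ 'n) \<times> real \<Rightarrow> real) \<Rightarrow> bool" where
  "strict_classical_supersolution p \<Omega> w \<longleftrightarrow>
    C2_on \<Omega> w \<and>
    (\<forall>z\<in>\<Omega>. \<forall>\<nu>. norm \<nu> = 1 \<and> spatial_gradient w z = (spatial_gradient w z \<bullet> \<nu>) *\<^sub>R \<nu> \<longrightarrow>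
      directional_p_laplacian p (spatial_hessian w z) \<nu> < time_derivative w z)"

lemma directional_p_laplacian_scaleR:
  "directional_p_laplacian p (b *\<^sub>R X) \<nu> = b * directional_p_laplacian p X \<nu>"
  by (simp add: directional_p_laplacian_def trace_def sum_distrib_left algebra_simps
      flip: scaleR_matrix_vector_assoc)

text \<open>
  This is ellipticity. For a nonnegative form \<open>M\<close> and \<open>q = M \<nu> \<bullet> \<nu>\<close> one has
  \<open>trace M + (p - 2) q \<ge> (p - 1) q \<ge> 0\<close>; the bound \<open>q \<le> trace M\<close> makes this work for \<open>p < 2\<close> as well.
\<close>

lemma directional_p_laplacian_mono:
  fixes X Y :: "real ^ 'n ^ 'n"
  assumes p: "1 < p" and \<nu>: "norm \<nu> = 1"
    and le: "\<And>v. (X *v v) \<bullet> v \<le> (Y *v v) \<bullet> v"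
  shows "directional_p_laplacian p X \<nu> \<le> directional_p_laplacian p Y \<nu>"
proof -
  define M where "M = Y - X"
  define q where "q = (M *v \<nu>) \<bullet> \<nu>"
  have psd: "0 \<le> (M *v v) \<bullet> v" for v
    using le[of v] by (simp add: M_def matrix_vector_mult_diff_rdistrib inner_diff_left)
  have q: "0 \<le> q" "q \<le> trace M" using psd trace_ge_quadratic_form[OF psd \<nu>] by (simp_all add: q_def)
  have "0 \<le> (p - 1) * q" using p q by simp
  also have "\<dots> = q + (p - 2) * q" by (simp add: algebra_simps)
  also have "\<dots> \<le> trace M + (p - 2) * q" using q by simp
  finally have "0 \<le> (trace M + (p - 2) * q) / p" using p by simp
  also have "\<dots> = directional_p_laplacian p Y \<nu> - directional_p_laplacian p X \<nu>"
    by (simp add: directional_p_laplacian_def M_def q_def trace_sub matrix_vector_mult_diff_rdistrib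
        inner_diff_left add_divide_distrib diff_divide_distrib algebra_simps)
  finally show ?thesis by simp
qed

definition viscosity_test :: "real \<Rightarrow> ((real ^ 'n) \<times> real \<Rightarrow> real) \<Rightarrow> (real ^ 'n) \<times> real \<Rightarrow> bool" where
  "viscosity_test p \<phi> z \<longleftrightarrow>
     (spatial_gradient \<phi> z \<noteq> 0 \<longrightarrow>
        time_derivative \<phi> z - normalised_p_laplacian p \<phi> z \<le> 0) \<and>
      (spatial_gradient \<phi> z = 0 \<longrightarrow>
        time_derivative \<phi> z - 1 / p * trace (spatial_hessian \<phi> z)
          - (p - 2) / p * (if p \<ge> 2 then max_eigenvalue (spatial_hessian \<phi> z)
                           else min_eigenvalue (spatial_hessian \<phi> z)) \<le> 0)"

lemma viscosity_subsolution_iff_test: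
  "viscosity_subsolution p \<Omega> u \<longleftrightarrow>
    upper_semicontinuous_on \<Omega> u \<and> essentially_bounded_on \<Omega> u \<and>
    (\<forall>\<phi> z. C2_on \<Omega> \<phi> \<and> z \<in> \<Omega> \<and> (\<forall>w\<in>\<Omega>. u w - \<phi> w \<le> u z - \<phi> z) \<longrightarrow> viscosity_test p \<phi> z)"
  unfolding viscosity_subsolution_def viscosity_test_def by (rule refl)

lemma viscosity_test_iff_directional:
  fixes \<phi> :: "(real ^ 'n) \<times> real \<Rightarrow> real"
  assumes "C2_on \<Omega> \<phi>" "open \<Omega>" "z \<in> \<Omega>"
  obtains \<nu> where "norm \<nu> = 1" "spatial_gradient \<phi> z = (spatial_gradient \<phi> z \<bullet> \<nu>) *\<^sub>R \<nu>"
    "viscosity_test p \<phi> z \<longleftrightarrow> time_derivative \<phi> z \<le> directional_p_laplacian p (spatial_hessian \<phi> z) \<nu>"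
proof (cases "spatial_gradient \<phi> z = 0")
  case True
  define X where "X = spatial_hessian \<phi> z"
  have sym: "transpose X = X"
    using C2_on_spatial_derivatives(4)[of \<Omega> \<phi> "fst z" "snd z"] assms by (simp add: X_def)
  define l where "l = (if p \<ge> 2 then max_eigenvalue X else min_eigenvalue X)"
  have "l \<in> real_eigenvalues X"
    using Max_in Min_in finite_real_eigenvalues[OF sym] symmetric_matrix_has_eigenvalue[OF sym]
    by (auto simp: l_def max_eigenvalue_def min_eigenvalue_def)
  then obtain e where e: "norm e = 1" "(X *v e) \<bullet> e = l" by (rule unit_eigenvector)
  show ?thesis
    by (rule that[of e]) (use True e[unfolded l_def] in \<open>auto simp: viscosity_test_def directional_p_laplacian_def simp flip: X_def\<close>)
next
  case False
  define \<nu> where "\<nu> = (1 / norm (spatial_gradient \<phi> z)) *\<^sub>R spatial_gradient \<phi> z"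
  have "norm \<nu> = 1" using False by (simp add: \<nu>_def)
  moreover have "spatial_gradient \<phi> z = (spatial_gradient \<phi> z \<bullet> \<nu>) *\<^sub>R \<nu>"
    using False by (simp add: \<nu>_def dot_square_norm power2_eq_square)
  moreover have "normalised_p_laplacian p \<phi> z = directional_p_laplacian p (spatial_hessian \<phi> z) \<nu>"
    by (simp add: normalised_p_laplacian_def directional_p_laplacian_def Let_def \<nu>_def)
  ultimately show ?thesis using that[of \<nu>] False by (simp add: viscosity_test_def)
qed

lemma continuous_on_imp_upper_semicontinuous_on:
  "continuous_on \<Omega> u \<Longrightarrow> upper_semicontinuous_on \<Omega> (u :: _ \<Rightarrow> real)"
  unfolding upper_semicontinuous_on_def continuous_on_def by (auto intro: order_tendstoD)

lemma continuous_on_imp_essentially_bounded_on: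
  assumes "open \<Omega>" "continuous_on \<Omega> u" "\<And>z. z \<in> \<Omega> \<Longrightarrow> \<bar>u z\<bar> \<le> M"
  shows "essentially_bounded_on \<Omega> u"
proof -
  have "\<Omega> \<in> sets lebesgue" using assms(1) by simp
  moreover from this have "AE z in lebesgue_on \<Omega>. \<bar>u z\<bar> \<le> M"
    using assms(3) by (intro AE_I2) (simp add: space_restrict_space)
  ultimately show ?thesis
    using continuous_imp_measurable_on_sets_lebesgue[OF assms(2)]
    unfolding essentially_bounded_on_def by blast
qed

text \<open>
  The operator is odd, so \<open>-w\<close> is a classical subsolution. At a point of contact with a test function
  the first derivatives agree, and ellipticity carries the inequality over to the test function.
\<close>

lemma viscosity_subsolution_of_supersolution:
  assumes p: "1 < p" and \<Omega>: "open \<Omega>" and w: "strict_classical_supersolution p \<Omega> w" and K: "0 < K"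
    and bound: "\<And>z. z \<in> \<Omega> \<Longrightarrow> \<bar>w z\<bar> \<le> M"
  shows "viscosity_subsolution p \<Omega> (\<lambda>z. a + (- K) * w z)"
proof -
  define u where "u = (\<lambda>z. a + (- K) * w z)"
  have w2: "C2_on \<Omega> w" using w by (simp add: strict_classical_supersolution_def)
  have u2: "C2_on \<Omega> u" unfolding u_def by (intro C2_on_add C2_on_mult C2_on_const w2)
  have cont: "continuous_on \<Omega> u" by (rule C2_on_imp_continuous_on[OF u2])
  have bounded: "\<bar>u z\<bar> \<le> \<bar>a\<bar> + K * M" if "z \<in> \<Omega>" for z
  proof -
    have "\<bar>u z\<bar> \<le> \<bar>a\<bar> + K * \<bar>w z\<bar>"
      using K abs_triangle_ineq4[of a "K * w z"] by (simp add: u_def abs_mult)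
    also have "\<dots> \<le> \<bar>a\<bar> + K * M" using K bound[OF that] by simp
    finally show ?thesis .
  qed
  have touch: "viscosity_test p \<phi> z"
    if \<phi>: "C2_on \<Omega> \<phi>" and z: "z \<in> \<Omega>" and max: "\<forall>w\<in>\<Omega>. u w - \<phi> w \<le> u z - \<phi> z" for \<phi> z
  proof -
    obtain \<nu> where \<nu>: "norm \<nu> = 1" "spatial_gradient \<phi> z = (spatial_gradient \<phi> z \<bullet> \<nu>) *\<^sub>R \<nu>"
      and iff: "viscosity_test p \<phi> z \<longleftrightarrow> time_derivative \<phi> z \<le> directional_p_laplacian p (spatial_hessian \<phi> z) \<nu>"
      by (rule viscosity_test_iff_directional[OF \<phi> \<Omega> z])
    note D = derivatives_at_interior_max[OF \<Omega> u2 \<phi> z max[rule_format]]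
    note A = spatial_gradient_affine[OF w2 \<Omega> z, of a "- K"]
      spatial_hessian_affine[OF w2 \<Omega> z, of a "- K"]
      time_derivative_affine[OF w2 \<Omega> z, of a "- K"]
    have "K *\<^sub>R spatial_gradient w z = K *\<^sub>R ((spatial_gradient w z \<bullet> \<nu>) *\<^sub>R \<nu>)"
      using \<nu>(2) D(1) A(1) by (simp add: u_def)
    then have "spatial_gradient w z = (spatial_gradient w z \<bullet> \<nu>) *\<^sub>R \<nu>"
      using K by (simp only: scaleR_cancel_left) simp
    then have "directional_p_laplacian p (spatial_hessian w z) \<nu> < time_derivative w z"
      using w z \<nu>(1) by (simp add: strict_classical_supersolution_def)
    then have "time_derivative u z \<le> directional_p_laplacian p (spatial_hessian u z) \<nu>"
      unfolding u_def A directional_p_laplacian_scaleR using K by simp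
    also have "\<dots> \<le> directional_p_laplacian p (spatial_hessian \<phi> z) \<nu>"
      by (rule directional_p_laplacian_mono[OF p \<nu>(1) D(3)])
    finally show ?thesis using iff D(2) by simp
  qed
  show ?thesis
    unfolding u_def[symmetric] viscosity_subsolution_iff_test
    using continuous_on_imp_upper_semicontinuous_on[OF cont]
      continuous_on_imp_essentially_bounded_on[OF \<Omega> cont bounded] touch
    by blast
qed

lemma strict_classical_supersolution_affine:
  assumes \<Omega>: "open \<Omega>" and w: "strict_classical_supersolution p \<Omega> w" and K: "0 < K"
  shows "strict_classical_supersolution p \<Omega> (\<lambda>z. a + K * w z)"
proof -
  have w2: "C2_on \<Omega> w" using w by (simp add: strict_classical_supersolution_def)
  show ?thesis
    unfolding strict_classical_supersolution_def
  proof (intro conjI ballI allI impI)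
    show "C2_on \<Omega> (\<lambda>z. a + K * w z)" by (intro C2_on_add C2_on_mult C2_on_const w2)
    fix z \<nu> assume z: "z \<in> \<Omega>"
    note A = spatial_gradient_affine[OF w2 \<Omega> z, of a K]
      spatial_hessian_affine[OF w2 \<Omega> z, of a K] time_derivative_affine[OF w2 \<Omega> z, of a K]
    assume \<nu>: "norm \<nu> = 1 \<and> spatial_gradient (\<lambda>z. a + K * w z) z =
      (spatial_gradient (\<lambda>z. a + K * w z) z \<bullet> \<nu>) *\<^sub>R \<nu>"
    then have "K *\<^sub>R spatial_gradient w z = K *\<^sub>R ((spatial_gradient w z \<bullet> \<nu>) *\<^sub>R \<nu>)"
      unfolding A by simp
    then have "spatial_gradient w z = (spatial_gradient w z \<bullet> \<nu>) *\<^sub>R \<nu>"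
      using K by (simp only: scaleR_cancel_left) simp
    then have "directional_p_laplacian p (spatial_hessian w z) \<nu> < time_derivative w z"
      using w z \<nu> by (simp add: strict_classical_supersolution_def)
    then show "directional_p_laplacian p (spatial_hessian (\<lambda>z. a + K * w z) z) \<nu>
        < time_derivative (\<lambda>z. a + K * w z) z"
      unfolding A directional_p_laplacian_scaleR using K by simp
  qed
qed

text \<open>
  At a maximum of \<open>v - w\<close> the function \<open>w\<close> itself is an admissible test function, and the resulting
  inequality contradicts strictness. Hence comparison with \<open>C\<^sup>2\<close> functions needs no doubling of
  variables.
\<close>

lemma no_max_against_strict_supersolution:
  assumes \<Omega>: "open \<Omega>" and v: "viscosity_subsolution p \<Omega> v"
    and w: "strict_classical_supersolution p \<Omega> w" and z: "z \<in> \<Omega>"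
  shows "\<exists>y\<in>\<Omega>. v z - w z < v y - w y"
proof (rule ccontr)
  assume "\<not> ?thesis"
  then have max: "\<forall>y\<in>\<Omega>. v y - w y \<le> v z - w z" by (simp add: not_less)
  have w2: "C2_on \<Omega> w" using w by (simp add: strict_classical_supersolution_def)
  have test: "viscosity_test p w z"
    using v w2 z max unfolding viscosity_subsolution_iff_test by blast
  show False
    by (rule viscosity_test_iff_directional[OF w2 \<Omega> z, of p])
      (use test w z in \<open>force simp: strict_classical_supersolution_def\<close>)
qed

text \<open>
  If no value were maximal, each \<open>z\<close> would have a better point \<open>b z\<close>, and the relatively open sets
  where \<open>g < g (b z)\<close> would cover \<open>C\<close>. The best of the points \<open>b z\<close> belonging to a finite subcover
  lies in none of its members.
\<close>

lemma upper_semicontinuous_attains_sup: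
  fixes g :: "'a::topological_space \<Rightarrow> real"
  assumes "compact C" "C \<noteq> {}" "upper_semicontinuous_on C g"
  shows "\<exists>z\<in>C. \<forall>y\<in>C. g y \<le> g z"
proof (rule ccontr)
  assume "\<not> ?thesis"
  then obtain b where b: "\<And>z. z \<in> C \<Longrightarrow> b z \<in> C \<and> g z < g (b z)" by (metis not_less)
  have "\<exists>U. open U \<and> z \<in> U \<and> (\<forall>y\<in>U \<inter> C. g y < g (b z))" if z: "z \<in> C" for z
  proof -
    have "\<forall>\<^sub>F y in at z within C. g y < g (b z)"
      using assms(3) b[OF z] z unfolding upper_semicontinuous_on_def by blast
    then obtain U where "open U" "z \<in> U" "\<forall>y\<in>U. y \<noteq> z \<longrightarrow> y \<in> C \<longrightarrow> g y < g (b z)"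
      unfolding eventually_at_topological by blast
    then show ?thesis using b[OF z] by (intro exI[of _ U]) (metis IntE)
  qed
  then obtain U where U: "\<And>z. z \<in> C \<Longrightarrow> open (U z) \<and> z \<in> U z \<and> (\<forall>y\<in>U z \<inter> C. g y < g (b z))"
    by metis
  obtain D where D: "D \<subseteq> C" "finite D" "C \<subseteq> (\<Union>z\<in>D. U z)"
    using compactE_image[OF assms(1), of C U] U by (metis UN_I subsetI)
  have "D \<noteq> {}" using D assms(2) by auto
  define m where "m = Max ((\<lambda>z. g (b z)) ` D)"
  have m: "g (b z) \<le> m" if "z \<in> D" for z using D that by (simp add: m_def)
  have "m \<in> (\<lambda>z. g (b z)) ` D" unfolding m_def using D \<open>D \<noteq> {}\<close> by (intro Max_in) auto
  then obtain z where z: "z \<in> D" "m = g (b z)" by blast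
  then have "b z \<in> C" using b D by blast
  then obtain y where "y \<in> D" "b z \<in> U y" using D by blast
  then have "g (b z) < g (b y)" using U[of y] \<open>b z \<in> C\<close> D by blast
  then show False using m[OF \<open>y \<in> D\<close>] z by simp
qed

text \<open>
  If \<open>v - w\<close> were positive at \<open>z\<close>, the boundary condition would make the set where \<open>v - w\<close> is at
  least its value at \<open>z\<close> compact in \<open>\<Omega>\<close>, and \<open>v - w\<close> would attain its maximum.
\<close>

lemma viscosity_subsolution_le_strict_supersolution:
  assumes \<Omega>: "open \<Omega>" "bounded \<Omega>" and v: "viscosity_subsolution p \<Omega> v"
    and w: "strict_classical_supersolution p \<Omega> w"
    and boundary: "\<And>\<zeta> \<sigma>. \<zeta> \<in> frontier \<Omega> \<Longrightarrow> 0 < \<sigma> \<Longrightarrow> \<forall>\<^sub>F \<eta> in at \<zeta> within \<Omega>. v \<eta> < w \<eta> + \<sigma>"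
    and z: "z \<in> \<Omega>"
  shows "v z \<le> w z"
proof (rule ccontr)
  assume "\<not> v z \<le> w z"
  define \<sigma> where "\<sigma> = v z - w z"
  have \<sigma>: "0 < \<sigma>" using \<open>\<not> v z \<le> w z\<close> by (simp add: \<sigma>_def)
  define C where "C = {y \<in> \<Omega>. \<sigma> \<le> v y - w y}"
  have cont_w: "continuous_on \<Omega> w"
    using w by (simp add: strict_classical_supersolution_def C2_on_imp_continuous_on)
  have usc: "\<forall>\<^sub>F y in at z within \<Omega>. v y - w y < a" if z: "z \<in> \<Omega>" and a: "v z - w z < a" for z a
  proof -
    define e where "e = (a - (v z - w z)) / 2"
    have "0 < e" using a by (simp add: e_def)
    then have "\<forall>\<^sub>F y in at z within \<Omega>. v y < v z + e"
      using v z unfolding viscosity_subsolution_def upper_semicontinuous_on_def by (simp add: less_add_same_cancel1)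
    moreover have "\<forall>\<^sub>F y in at z within \<Omega>. w z - e < w y"
      using cont_w z \<open>0 < e\<close> unfolding continuous_on_def by (auto intro: order_tendstoD)
    ultimately show ?thesis by eventually_elim (simp add: e_def field_simps)
  qed
  have near: "\<forall>\<^sub>F y in at \<zeta> within \<Omega>. v y - w y < \<sigma>" if "\<zeta> \<in> closure \<Omega>" "\<zeta> \<notin> C" for \<zeta>
  proof (cases "\<zeta> \<in> \<Omega>")
    case True
    then show ?thesis using usc that by (simp add: C_def)
  next
    case False
    then have "\<zeta> \<in> frontier \<Omega>" using that \<Omega> by (simp add: frontier_def interior_open)
    from boundary[OF this \<sigma>] show ?thesis by (rule eventually_mono) simp
  qed
  have "closed C"
    unfolding closed_limpt
  proof (intro allI impI)
    fix \<zeta> assume lim: "\<zeta> islimpt C"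
    show "\<zeta> \<in> C"
    proof (rule ccontr)
      assume "\<zeta> \<notin> C"
      have "C \<subseteq> \<Omega>" by (auto simp: C_def)
      then have "\<zeta> \<in> closure \<Omega>" using islimpt_subset[OF lim] by (simp add: closure_def)
      then have "\<forall>\<^sub>F y in at \<zeta> within C. v y - w y < \<sigma>"
        by (rule filter_leD[OF at_le[OF \<open>C \<subseteq> \<Omega>\<close>] near]) fact
      moreover have "\<forall>\<^sub>F y in at \<zeta> within C. \<not> v y - w y < \<sigma>"
        by (auto simp: eventually_at_filter C_def)
      ultimately have "\<forall>\<^sub>F y in at \<zeta> within C. False" by eventually_elim simp
      then show False using lim by (simp add: trivial_limit_within)
    qed
  qed
  then have "compact C"
    using bounded_subset[OF \<Omega>(2), of C] by (auto simp: compact_eq_bounded_closed C_def)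
  moreover have "z \<in> C" using z by (simp add: C_def \<sigma>_def)
  moreover have "upper_semicontinuous_on C (\<lambda>y. v y - w y)"
    unfolding upper_semicontinuous_on_def
  proof (intro ballI allI impI)
    fix y a assume "y \<in> C" "v y - w y < a"
    then have "\<forall>\<^sub>F y in at y within \<Omega>. v y - w y < a" by (intro usc) (auto simp: C_def)
    moreover have "at y within C \<le> at y within \<Omega>" by (rule at_le) (auto simp: C_def)
    ultimately show "\<forall>\<^sub>F y in at y within C. v y - w y < a" by (simp add: filter_leD)
  qed
  ultimately obtain m where m: "m \<in> C" "\<And>y. y \<in> C \<Longrightarrow> v y - w y \<le> v m - w m"
    using upper_semicontinuous_attains_sup[of C "\<lambda>y. v y - w y"] by blast
  have "v y - w y \<le> v m - w m" if "y \<in> \<Omega>" for y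
    using m that by (cases "y \<in> C") (auto simp: C_def)
  moreover have "m \<in> \<Omega>" using m(1) by (simp add: C_def)
  ultimately show False
    using no_max_against_strict_supersolution[OF \<Omega>(1) v w] by (metis not_less)
qed

section \<open>Barriers\<close>

text \<open>
  Near \<open>\<zeta>\<^sub>0\<close> the oscillation of \<open>f\<close> is below \<open>\<epsilon>\<close> by continuity; away from \<open>\<zeta>\<^sub>0\<close> a large multiple of
  the barrier dominates the oscillation of the bounded function \<open>f\<close>.
\<close>

lemma barrier_controls_boundary_data:
  fixes f w :: "'a::metric_space \<Rightarrow> real"
  assumes \<zeta>0: "\<zeta>\<^sub>0 \<in> F"
    and f: "continuous_on F f" "bounded (f ` F)"
    and w: "\<And>\<eta>. \<eta> \<in> \<Omega> \<Longrightarrow> 0 < w \<eta>"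
    and away: "\<And>\<delta>. 0 < \<delta> \<Longrightarrow> \<exists>m>0. \<forall>\<eta>\<in>\<Omega>. \<delta> \<le> dist \<eta> \<zeta>\<^sub>0 \<longrightarrow> m \<le> w \<eta>"
    and \<epsilon>: "0 < \<epsilon>"
  obtains K where "0 < K"
    "\<And>\<zeta>. \<zeta> \<in> F \<Longrightarrow> \<forall>\<^sub>F \<eta> in at \<zeta> within \<Omega>. \<bar>f \<zeta> - f \<zeta>\<^sub>0\<bar> \<le> \<epsilon> + K * w \<eta>"
proof -
  obtain M where M: "\<And>\<zeta>. \<zeta> \<in> F \<Longrightarrow> \<bar>f \<zeta>\<bar> \<le> M"
    using f(2) by (auto simp: bounded_iff)
  obtain \<delta> where \<delta>: "0 < \<delta>" "\<And>\<zeta>. \<zeta> \<in> F \<Longrightarrow> dist \<zeta> \<zeta>\<^sub>0 < \<delta> \<Longrightarrow> \<bar>f \<zeta> - f \<zeta>\<^sub>0\<bar> < \<epsilon>"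
    using f(1) \<zeta>0 \<epsilon> unfolding continuous_on_iff dist_real_def by metis
  obtain m where m: "0 < m" "\<And>\<eta>. \<eta> \<in> \<Omega> \<Longrightarrow> \<delta> / 2 \<le> dist \<eta> \<zeta>\<^sub>0 \<Longrightarrow> m \<le> w \<eta>"
    using away[of "\<delta> / 2"] \<delta>(1) by auto
  define K where "K = (2 * \<bar>M\<bar> + 1) / m"
  have K: "0 < K" using m by (simp add: K_def add_nonneg_pos)
  show ?thesis
  proof (rule that[OF K])
    fix \<zeta> assume \<zeta>: "\<zeta> \<in> F"
    show "\<forall>\<^sub>F \<eta> in at \<zeta> within \<Omega>. \<bar>f \<zeta> - f \<zeta>\<^sub>0\<bar> \<le> \<epsilon> + K * w \<eta>"
    proof (cases "dist \<zeta> \<zeta>\<^sub>0 < \<delta>")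
      case True
      then have "\<bar>f \<zeta> - f \<zeta>\<^sub>0\<bar> \<le> \<epsilon> + K * w \<eta>" if "\<eta> \<in> \<Omega>" for \<eta>
        using \<delta>(2)[OF \<zeta>] K w[OF that] by (smt (verit) mult_pos_pos)
      then show ?thesis by (auto simp: eventually_at_filter)
    next
      case False
      have "\<bar>f \<zeta> - f \<zeta>\<^sub>0\<bar> \<le> \<epsilon> + K * w \<eta>" if "\<eta> \<in> \<Omega>" "dist \<eta> \<zeta> < \<delta> / 2" for \<eta>
      proof -
        have "\<delta> / 2 \<le> dist \<eta> \<zeta>\<^sub>0"
          using False that(2) dist_triangle2[of \<zeta> \<zeta>\<^sub>0 \<eta>] dist_triangle[of \<zeta> \<zeta>\<^sub>0 \<eta>] by (simp add: dist_commute)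
        then have "K * m \<le> K * w \<eta>" using m(2)[OF that(1)] K by (intro mult_left_mono) auto
        then have "2 * \<bar>M\<bar> + 1 \<le> K * w \<eta>" using m(1) by (simp add: K_def)
        then show ?thesis using M[OF \<zeta>] M[OF \<zeta>0] \<epsilon> by linarith
      qed
      then show ?thesis unfolding eventually_at using \<delta>(1) by (intro exI[of _ "\<delta> / 2"]) auto
    qed
  qed
qed

text \<open>
  The function \<open>f \<zeta>\<^sub>0 - \<epsilon> - K w\<close> belongs to the lower class, hence bounds the Perron solution from
  below. The function \<open>f \<zeta>\<^sub>0 + \<epsilon> + K w\<close> is a strict supersolution that dominates the boundary data,
  hence bounds every member of the lower class from above.
\<close>

lemma regular_boundary_point_if_barrier:
  fixes w :: "(real ^ 'n) \<times> real \<Rightarrow> real"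
  assumes p: "1 < p" and \<Omega>: "open \<Omega>" "bounded \<Omega>" and \<zeta>0: "\<zeta>\<^sub>0 \<in> frontier \<Omega>"
    and super: "strict_classical_supersolution p \<Omega> w"
    and pos: "\<And>\<eta>. \<eta> \<in> \<Omega> \<Longrightarrow> 0 < w \<eta>" and bound: "\<And>\<eta>. \<eta> \<in> \<Omega> \<Longrightarrow> w \<eta> \<le> M"
    and lim: "(w \<longlongrightarrow> 0) (at \<zeta>\<^sub>0 within \<Omega>)"
    and away: "\<And>\<delta>. 0 < \<delta> \<Longrightarrow> \<exists>m>0. \<forall>\<eta>\<in>\<Omega>. \<delta> \<le> dist \<eta> \<zeta>\<^sub>0 \<longrightarrow> m \<le> w \<eta>"
  shows "regular_boundary_point p \<Omega> \<zeta>\<^sub>0"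
  unfolding regular_boundary_point_def
proof (intro conjI \<zeta>0 allI impI)
  fix f :: "(real ^ 'n) \<times> real \<Rightarrow> real"
  assume "continuous_on (frontier \<Omega>) f \<and> bounded (f ` frontier \<Omega>)"
  then have f: "continuous_on (frontier \<Omega>) f" "bounded (f ` frontier \<Omega>)" by auto
  let ?H = "lower_perron_solution p \<Omega> f"
  have squeeze: "\<forall>\<^sub>F \<eta> in at \<zeta>\<^sub>0 within \<Omega>.
      ereal (f \<zeta>\<^sub>0 - 2 * \<epsilon>) \<le> ?H \<eta> \<and> ?H \<eta> \<le> ereal (f \<zeta>\<^sub>0 + 2 * \<epsilon>)" if \<epsilon>: "0 < \<epsilon>" for \<epsilon>
  proof -
    obtain K where K: "0 < K" and data:
      "\<And>\<zeta>. \<zeta> \<in> frontier \<Omega> \<Longrightarrow> \<forall>\<^sub>F \<eta> in at \<zeta> within \<Omega>. \<bar>f \<zeta> - f \<zeta>\<^sub>0\<bar> \<le> \<epsilon> + K * w \<eta>"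
      using barrier_controls_boundary_data[OF \<zeta>0 f pos away \<epsilon>] by metis
    define lower where "lower = (\<lambda>\<eta>. (f \<zeta>\<^sub>0 - \<epsilon>) + (- K) * w \<eta>)"
    define upper where "upper = (\<lambda>\<eta>. (f \<zeta>\<^sub>0 + \<epsilon>) + K * w \<eta>)"
    have "viscosity_subsolution p \<Omega> lower"
      unfolding lower_def
      by (rule viscosity_subsolution_of_supersolution[OF p \<Omega>(1) super K, of M])
        (use pos bound in \<open>force simp: abs_of_pos\<close>)
    moreover have "Limsup (at \<zeta> within \<Omega>) (\<lambda>\<eta>. ereal (lower \<eta>)) \<le> ereal (f \<zeta>)"
      if "\<zeta> \<in> frontier \<Omega>" for \<zeta>
    proof (rule Limsup_bounded)
      show "\<forall>\<^sub>F \<eta> in at \<zeta> within \<Omega>. ereal (lower \<eta>) \<le> ereal (f \<zeta>)"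
        using data[OF that] by eventually_elim (simp add: lower_def)
    qed
    ultimately have "lower \<in> perron_lower_class p \<Omega> f"
      by (simp add: perron_lower_class_def)
    then have below: "ereal (lower \<eta>) \<le> ?H \<eta>" for \<eta>
      unfolding lower_perron_solution_def by (rule SUP_upper)
    have upper: "strict_classical_supersolution p \<Omega> upper"
      unfolding upper_def by (rule strict_classical_supersolution_affine[OF \<Omega>(1) super K])
    have "v \<eta> \<le> upper \<eta>" if v: "v \<in> perron_lower_class p \<Omega> f" and \<eta>: "\<eta> \<in> \<Omega>" for v \<eta>
    proof (rule viscosity_subsolution_le_strict_supersolution[OF \<Omega> _ upper _ \<eta>])
      show "viscosity_subsolution p \<Omega> v" using v by (simp add: perron_lower_class_def)
      fix \<zeta> and \<sigma> :: real assume \<zeta>: "\<zeta> \<in> frontier \<Omega>" and \<sigma>: "0 < \<sigma>"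
      have "Limsup (at \<zeta> within \<Omega>) (\<lambda>\<eta>. ereal (v \<eta>)) < ereal (f \<zeta> + \<sigma>)"
        using v \<zeta> \<sigma> by (force simp: perron_lower_class_def intro: le_less_trans)
      then have "\<forall>\<^sub>F \<eta> in at \<zeta> within \<Omega>. ereal (v \<eta>) < ereal (f \<zeta> + \<sigma>)" by (rule Limsup_lessD)
      with data[OF \<zeta>] show "\<forall>\<^sub>F \<eta> in at \<zeta> within \<Omega>. v \<eta> < upper \<eta> + \<sigma>"
        by eventually_elim (simp add: upper_def)
    qed
    then have above: "?H \<eta> \<le> ereal (upper \<eta>)" if "\<eta> \<in> \<Omega>" for \<eta>
      unfolding lower_perron_solution_def using that by (intro SUP_least) simp
    have "\<forall>\<^sub>F \<eta> in at \<zeta>\<^sub>0 within \<Omega>. w \<eta> < \<epsilon> / K"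
      using order_tendstoD(2)[OF lim, of "\<epsilon> / K"] \<epsilon> K by simp
    moreover have "\<forall>\<^sub>F \<eta> in at \<zeta>\<^sub>0 within \<Omega>. \<eta> \<in> \<Omega>" by (simp add: eventually_at_filter)
    ultimately show ?thesis
    proof eventually_elim
      case (elim \<eta>)
      then have "K * w \<eta> \<le> \<epsilon>" using K by (simp add: field_simps)
      then have "ereal (f \<zeta>\<^sub>0 - 2 * \<epsilon>) \<le> ereal (lower \<eta>)" "ereal (upper \<eta>) \<le> ereal (f \<zeta>\<^sub>0 + 2 * \<epsilon>)"
        by (simp_all add: lower_def upper_def)
      then show ?case using below[of \<eta>] above[OF elim(2)] by (meson order_trans)
    qed
  qed
  show "(?H \<longlongrightarrow> ereal (f \<zeta>\<^sub>0)) (at \<zeta>\<^sub>0 within \<Omega>)"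
  proof (rule order_tendstoI)
    fix a assume "a < ereal (f \<zeta>\<^sub>0)"
    then obtain b where b: "a < ereal b" "ereal b < ereal (f \<zeta>\<^sub>0)" using ereal_dense2 by blast
    have "\<forall>\<^sub>F \<eta> in at \<zeta>\<^sub>0 within \<Omega>. ereal b \<le> ?H \<eta>"
    proof -
      define \<epsilon> where "\<epsilon> = (f \<zeta>\<^sub>0 - b) / 2"
      have "b = f \<zeta>\<^sub>0 - 2 * \<epsilon>" "0 < \<epsilon>" using b(2) by (auto simp: \<epsilon>_def field_simps)
      then show ?thesis using squeeze[of \<epsilon>] by (auto elim: eventually_mono)
    qed
    then show "\<forall>\<^sub>F \<eta> in at \<zeta>\<^sub>0 within \<Omega>. a < ?H \<eta>" by eventually_elim (use b in order)
  next
    fix a assume "ereal (f \<zeta>\<^sub>0) < a"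
    then obtain b where b: "ereal b < a" "ereal (f \<zeta>\<^sub>0) < ereal b" using ereal_dense2 by blast
    have "\<forall>\<^sub>F \<eta> in at \<zeta>\<^sub>0 within \<Omega>. ?H \<eta> \<le> ereal b"
    proof -
      define \<epsilon> where "\<epsilon> = (b - f \<zeta>\<^sub>0) / 2"
      have "b = f \<zeta>\<^sub>0 + 2 * \<epsilon>" "0 < \<epsilon>" using b(2) by (auto simp: \<epsilon>_def field_simps)
      then show ?thesis using squeeze[of \<epsilon>] by (auto elim: eventually_mono)
    qed
    then show "\<forall>\<^sub>F \<eta> in at \<zeta>\<^sub>0 within \<Omega>. ?H \<eta> < a" by eventually_elim (use b in order)
  qed
qed

section \<open>Derivatives of Gaussian profiles\<close>

definition gaussian_profile ::
    "real \<Rightarrow> (real \<Rightarrow> real) \<Rightarrow> (real \<Rightarrow> real) \<Rightarrow> (real ^ 'n) \<times> real \<Rightarrow> real" where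
  "gaussian_profile \<beta> A B = (\<lambda>(x, t). A t + B t * exp ((norm x)\<^sup>2 / (\<beta> * - t)))"

lemma
  fixes x :: "real ^ 'n"
  shows spatial_gradient_gaussian_profile:
      "spatial_gradient (gaussian_profile \<beta> A B) (x, t) =
        (2 * B t * exp ((norm x)\<^sup>2 / (\<beta> * - t)) / (\<beta> * - t)) *\<^sub>R x" (is "_ = ?m x *\<^sub>R x")
    and spatial_hessian_gaussian_profile:
      "spatial_hessian (gaussian_profile \<beta> A B) (x, t) =
        (2 * B t * exp ((norm x)\<^sup>2 / (\<beta> * - t)) / (\<beta> * - t)) *\<^sub>R
          (mat 1 + (2 / (\<beta> * - t)) *\<^sub>R (\<chi> i j. x $ i * x $ j))"
proof -
  define k where "k = 1 / (\<beta> * - t)"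
  have m: "?m y = 2 * B t * exp (k * (y \<bullet> y)) * k" for y :: "real ^ 'n"
    by (simp add: k_def power2_norm_eq_inner)
  have grad: "spatial_gradient (gaussian_profile \<beta> A B) (y, t) = ?m y *\<^sub>R y" for y :: "real ^ 'n"
  proof (rule spatial_gradient_eqI)
    have "((\<lambda>y. A t + B t * exp (k * (y \<bullet> y))) has_derivative (\<lambda>h. ?m y *\<^sub>R y \<bullet> h)) (at y)"
      unfolding m by (auto intro!: derivative_eq_intros simp: fun_eq_iff inner_commute algebra_simps)
    then show "((\<lambda>y. gaussian_profile \<beta> A B (y, t)) has_derivative (\<lambda>h. ?m y *\<^sub>R y \<bullet> h)) (at y)"
      by (simp add: gaussian_profile_def k_def power2_norm_eq_inner)
  qed
  show "spatial_gradient (gaussian_profile \<beta> A B) (x, t) = ?m x *\<^sub>R x" by (rule grad)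
  show "spatial_hessian (gaussian_profile \<beta> A B) (x, t) =
      ?m x *\<^sub>R (mat 1 + (2 / (\<beta> * - t)) *\<^sub>R (\<chi> i j. x $ i * x $ j))"
  proof (rule spatial_hessian_eqI, unfold grad)
    have outer: "(\<chi> i j. x $ i * x $ j) *v h = (x \<bullet> h) *\<^sub>R x" for h
      by (simp add: vec_eq_iff matrix_vector_mult_def inner_vec_def sum_distrib_left mult_ac)
    have D: "((\<lambda>y. ?m y *\<^sub>R y) has_derivative (\<lambda>h. ?m x *\<^sub>R h + (?m x * (2 * k * (x \<bullet> h))) *\<^sub>R x)) (at x)"
      unfolding m
      by (auto intro!: derivative_eq_intros simp: fun_eq_iff inner_commute algebra_simps)
    have G: "m *\<^sub>R h + (m * (2 * k * (x \<bullet> h))) *\<^sub>R x =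
        (m *\<^sub>R (mat 1 + (2 * k) *\<^sub>R (\<chi> i j. x $ i * x $ j))) *v h" for m h
      by (simp add: matrix_vector_mult_add_rdistrib outer scaleR_right_distrib
          flip: scaleR_matrix_vector_assoc)
    have k2: "2 / (\<beta> * - t) = 2 * k" by (simp add: k_def)
    show "((\<lambda>y. ?m y *\<^sub>R y) has_derivative (\<lambda>h. (?m x *\<^sub>R
        (mat 1 + (2 / (\<beta> * - t)) *\<^sub>R (\<chi> i j. x $ i * x $ j))) *v h)) (at x)"
      unfolding k2 G[symmetric] by (rule D)
  qed
qed

lemma time_derivative_gaussian_profile:
  assumes "(A has_real_derivative A') (at t)" "(B has_real_derivative B') (at t)"
    and "t \<noteq> 0" "\<beta> \<noteq> 0"
  shows "time_derivative (gaussian_profile \<beta> A B) (x, t) =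
    A' + B' * exp ((norm x)\<^sup>2 / (\<beta> * - t)) + B t * exp ((norm x)\<^sup>2 / (\<beta> * - t)) * ((norm x)\<^sup>2 / (\<beta> * t\<^sup>2))"
  by (rule time_derivative_eqI, unfold gaussian_profile_def prod.case)
    (use assms in \<open>auto intro!: derivative_eq_intros simp: power2_eq_square field_simps\<close>)

text \<open>
  The terms with \<open>(norm x)\<^sup>2\<close> in the time derivative and in the \<open>p\<close>-Laplacian cancel exactly for
  \<open>\<beta> = 4 (p - 1) / p\<close>: in the radial direction the diffusion coefficient is \<open>(p - 1) / p\<close>, and
  \<open>exp (r\<^sup>2 / (4 \<kappa> h))\<close> is, up to a power of \<open>h\<close>, the heat kernel with coefficient \<open>\<kappa>\<close> continued to
  the negative time \<open>- h\<close>.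
\<close>

lemma parabolic_operator_gaussian_profile:
  fixes x \<nu> :: "real ^ 'n"
  assumes p: "1 < p" and \<beta>: "\<beta> = 4 * ((p - 1) / p)" and t: "t < 0" and Bt: "B t \<noteq> 0"
    and A: "(A has_real_derivative A') (at t)" and B: "(B has_real_derivative B') (at t)"
    and \<nu>: "norm \<nu> = 1" "spatial_gradient (gaussian_profile \<beta> A B) (x, t) =
      (spatial_gradient (gaussian_profile \<beta> A B) (x, t) \<bullet> \<nu>) *\<^sub>R \<nu>"
  shows "time_derivative (gaussian_profile \<beta> A B) (x, t)
      - directional_p_laplacian p (spatial_hessian (gaussian_profile \<beta> A B) (x, t)) \<nu>
    = A' + exp ((norm x)\<^sup>2 / (\<beta> * - t)) * (B' - B t * (real CARD('n) + p - 2) / (2 * (p - 1) * - t))"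
proof -
  define E where "E = exp ((norm x)\<^sup>2 / (\<beta> * - t))"
  define k where "k = 1 / (\<beta> * - t)"
  have \<beta>0: "0 < \<beta>" using p by (simp add: \<beta>)
  have k: "0 < k" using \<beta>0 t by (simp add: k_def mult_pos_neg)
  define m where "m = 2 * B t * E * k"
  have m0: "m \<noteq> 0" using k Bt by (simp add: m_def E_def)
  have "spatial_gradient (gaussian_profile \<beta> A B) (x, t) = m *\<^sub>R x"
    by (simp add: spatial_gradient_gaussian_profile m_def E_def k_def)
  with \<nu>(2) have "m *\<^sub>R x = m *\<^sub>R ((x \<bullet> \<nu>) *\<^sub>R \<nu>)" by simp
  then have "x = (x \<bullet> \<nu>) *\<^sub>R \<nu>" using m0 by (simp only: scaleR_cancel_left) simp
  then have "norm x = \<bar>x \<bullet> \<nu>\<bar>" using \<nu>(1) by (metis norm_scaleR mult_1_right)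
  \<comment> \<open>For \<open>x = 0\<close> both sides vanish, whatever the unit vector \<open>\<nu>\<close> is.\<close>
  then have x\<nu>: "(x \<bullet> \<nu>)\<^sup>2 = (norm x)\<^sup>2" by simp
  have outer: "(\<chi> i j. x $ i * x $ j) *v \<nu> = (x \<bullet> \<nu>) *\<^sub>R x"
    by (simp add: vec_eq_iff matrix_vector_mult_def inner_vec_def sum_distrib_left mult_ac)
  have X: "spatial_hessian (gaussian_profile \<beta> A B) (x, t) =
      m *\<^sub>R (mat 1 + (2 * k) *\<^sub>R (\<chi> i j. x $ i * x $ j))"
    by (simp add: spatial_hessian_gaussian_profile m_def E_def k_def)
  have "trace (mat 1 + (2 * k) *\<^sub>R (\<chi> i j. x $ i * x $ j)) = real CARD('n) + 2 * k * (norm x)\<^sup>2"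
    by (simp add: trace_add trace_I)
      (simp add: trace_def power2_norm_eq_inner inner_vec_def sum_distrib_left)
  moreover have "((mat 1 + (2 * k) *\<^sub>R (\<chi> i j. x $ i * x $ j)) *v \<nu>) \<bullet> \<nu> = 1 + 2 * k * (norm x)\<^sup>2"
    using \<nu>(1) x\<nu> by (simp add: matrix_vector_mult_add_rdistrib outer inner_add_left norm_eq_1
        power2_eq_square flip: scaleR_matrix_vector_assoc)
  ultimately have "directional_p_laplacian p (spatial_hessian (gaussian_profile \<beta> A B) (x, t)) \<nu>
      = m * (1 / p * (real CARD('n) + 2 * k * (norm x)\<^sup>2) + (p - 2) / p * (1 + 2 * k * (norm x)\<^sup>2))"
    unfolding X directional_p_laplacian_scaleR by (simp add: directional_p_laplacian_def)
  also have "\<dots> = m * ((real CARD('n) + p - 2) / p) + m * 2 * k * ((p - 1) / p) * (norm x)\<^sup>2"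
    using p by (simp add: field_simps)
  also have "m * 2 * k * ((p - 1) / p) * (norm x)\<^sup>2 = B t * E * ((norm x)\<^sup>2 / (\<beta> * t\<^sup>2))"
  proof -
    have "4 * ((p - 1) / p) * k = \<beta> * k" by (simp only: \<beta>)
    then have "4 * ((p - 1) / p) * k = 1 / - t" using \<beta>0 by (simp add: k_def)
    moreover have "m * 2 * k * ((p - 1) / p) * (norm x)\<^sup>2
        = B t * E * ((norm x)\<^sup>2 * (k * (4 * ((p - 1) / p) * k)))"
      by (simp add: m_def)
    ultimately have "m * 2 * k * ((p - 1) / p) * (norm x)\<^sup>2 = B t * E * ((norm x)\<^sup>2 * (k * (1 / - t)))"
      by (simp only:)
    then show ?thesis by (simp add: k_def power2_eq_square)
  qed
  also have "m * ((real CARD('n) + p - 2) / p) = E * (B t * (real CARD('n) + p - 2) / (2 * (p - 1) * - t))"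
  proof -
    define r where "r = 2 * (p - 1) * - t"
    have "k / p = 1 / (2 * r)" using p by (simp add: k_def \<beta> r_def)
    moreover have "m * ((real CARD('n) + p - 2) / p) = 2 * B t * E * (real CARD('n) + p - 2) * (k / p)"
      by (simp add: m_def)
    ultimately have "m * ((real CARD('n) + p - 2) / p)
        = 2 * B t * E * (real CARD('n) + p - 2) * (1 / (2 * r))"
      by (simp only:)
    then show ?thesis unfolding r_def[symmetric] by simp
  qed
  finally show ?thesis
    using time_derivative_gaussian_profile[OF A B, of \<beta> x] t \<beta>0
    by (simp add: E_def algebra_simps)
qed

section \<open>The iterated logarithm barrier\<close>

definition petrovskii_domain :: "real \<Rightarrow> real \<Rightarrow> ((real ^ 'n) \<times> real) set" where
  "petrovskii_domain \<beta> c =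
    {(x, t). - c < t \<and> t < 0 \<and> (norm x)\<^sup>2 < \<beta> * - t * ln (- ln (- t))}"

text \<open>
  In the self-similar variables \<open>s = - ln (- t)\<close> and \<open>y = x / sqrt (- t)\<close> this is
  \<open>s\<^bsup>-1/8\<^esup> (1 - E / (2 s))\<close> with \<open>E = exp ((norm y)\<^sup>2 / \<beta>)\<close>. The factor in parentheses imitates the first
  Dirichlet eigenfunction of the rescaled operator on the slice \<open>E < s\<close>, whose eigenvalue is at least
  of order \<open>1 / s\<close>; the power of \<open>s\<close> is the resulting decay in time. Any sufficiently small
  exponent would do.
\<close>

definition petrovskii_barrier :: "real \<Rightarrow> (real ^ 'n) \<times> real \<Rightarrow> real" where
  "petrovskii_barrier \<beta> = gaussian_profile \<beta>
    (\<lambda>t. (- ln (- t)) powr (- 1 / 8)) (\<lambda>t. - 1 / 2 * (- ln (- t)) powr (- 9 / 8))"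

lemma petrovskii_domainD:
  assumes z: "(x, t) \<in> petrovskii_domain \<beta> c" and \<beta>: "0 < \<beta>" and c: "c < 1"
  shows "- 1 < t" "t < 0" "1 < - ln (- t)" "exp ((norm x)\<^sup>2 / (\<beta> * - t)) < - ln (- t)"
proof -
  show t: "- 1 < t" "t < 0" using z c by (auto simp: petrovskii_domain_def)
  have x: "(norm x)\<^sup>2 < \<beta> * - t * ln (- ln (- t))" using z by (simp add: petrovskii_domain_def)
  have h: "0 < \<beta> * - t" using \<beta> t by (simp add: mult_pos_neg)
  have s: "0 < - ln (- t)" using t by simp
  have "0 < \<beta> * - t * ln (- ln (- t))" using x by (meson le_less_trans zero_le_power2)
  then have "0 < ln (- ln (- t))" using h by (metis zero_less_mult_pos)
  then show "1 < - ln (- t)" using s by (metis ln_gt_zero_iff)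
  have "(norm x)\<^sup>2 / (\<beta> * - t) < ln (- ln (- t))"
    using x h by (simp only: pos_divide_less_eq mult.commute)
  then show "exp ((norm x)\<^sup>2 / (\<beta> * - t)) < - ln (- t)" using s by (metis exp_less_mono exp_ln)
qed

lemma neg_ln_le_inverse_sqrt:
  fixes h :: real
  assumes "0 < h"
  shows "- ln h \<le> 2 / sqrt h"
proof -
  have "- ln h = 2 * ln (1 / sqrt h)" using assms by (simp add: ln_div ln_sqrt)
  also have "\<dots> \<le> 2 * (1 / sqrt h)"
    using assms ln_le_minus_one[of "1 / sqrt h"] by simp
  finally show ?thesis by simp
qed

text \<open>
  The points of the domain approach the origin uniformly as \<open>t \<rightarrow> 0\<close>. This crude bound on the size
  of the slices gives boundedness and, read backwards, keeps \<open>t\<close> away from \<open>0\<close> outside every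
  neighbourhood of the origin.
\<close>

lemma petrovskii_domain_norm_bound:
  assumes z: "(x, t) \<in> petrovskii_domain \<beta> c" and \<beta>: "0 < \<beta>" and c: "c < 1"
  shows "(norm (x, t))\<^sup>2 \<le> (2 * \<beta> + 1) * sqrt (- t)"
proof -
  note D = petrovskii_domainD[OF z \<beta> c]
  define r where "r = sqrt (- t)"
  have r: "0 < r" "r \<le> 1" "- t = r\<^sup>2" using D by (auto simp: r_def)
  have "(norm x)\<^sup>2 \<le> \<beta> * - t * ln (- ln (- t))" using z by (simp add: petrovskii_domain_def)
  also have "\<dots> \<le> \<beta> * r\<^sup>2 * (2 / r)"
  proof -
    have "ln (- ln (- t)) \<le> - ln (- t)" using D(3) ln_le_minus_one[of "- ln (- t)"] by simp
    also have "\<dots> \<le> 2 / r" unfolding r_def using D(2) by (intro neg_ln_le_inverse_sqrt) simp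
    finally have "ln (- ln (- t)) \<le> 2 / r" .
    then show ?thesis unfolding r(3) using \<beta> by (intro mult_left_mono) auto
  qed
  also have "\<dots> = 2 * \<beta> * r" using r(1) by (simp add: power2_eq_square)
  finally have "(norm x)\<^sup>2 \<le> 2 * \<beta> * r" .
  moreover have "t\<^sup>2 \<le> r"
  proof -
    have "t\<^sup>2 = r * r ^ 3" using r(3) by (metis power2_minus power2_eq_square power3_eq_cube mult.assoc)
    also have "\<dots> \<le> r * 1" using r by (intro mult_left_mono power_le_one) auto
    finally show ?thesis by simp
  qed
  moreover have "(norm (x, t))\<^sup>2 = (norm x)\<^sup>2 + t\<^sup>2" by (simp add: norm_Pair)
  ultimately show ?thesis by (simp add: r_def algebra_simps)
qed

lemma bounded_petrovskii_domain:
  assumes "0 < \<beta>" "c < 1"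
  shows "bounded (petrovskii_domain \<beta> c :: ((real ^ 'n) \<times> real) set)"
proof -
  have "norm z \<le> sqrt (2 * \<beta> + 1)" if z: "z \<in> petrovskii_domain \<beta> c" for z :: "(real ^ 'n) \<times> real"
  proof -
    obtain x t where xt: "z = (x, t)" by (cases z)
    have "(norm z)\<^sup>2 \<le> (2 * \<beta> + 1) * sqrt (- t)"
      using petrovskii_domain_norm_bound z assms unfolding xt by blast
    also have "\<dots> \<le> (2 * \<beta> + 1) * 1"
      using petrovskii_domainD[of x t \<beta> c] z assms unfolding xt by (intro mult_left_mono) auto
    finally show ?thesis by (simp add: real_le_rsqrt)
  qed
  then show ?thesis unfolding bounded_iff by blast
qed

lemma open_petrovskii_domain:
  assumes "c < 1"
  shows "open (petrovskii_domain \<beta> c :: ((real ^ 'n) \<times> real) set)"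
proof -
  define U where "U = {z :: (real ^ 'n) \<times> real. - c < snd z \<and> snd z < 0}"
  define g where "g z = \<beta> * - snd z * ln (- ln (- snd z)) - (norm (fst z))\<^sup>2" for z :: "(real ^ 'n) \<times> real"
  have "open U" unfolding U_def by (intro open_Collect_conj open_Collect_less continuous_intros)
  moreover have "continuous_on U g"
    unfolding g_def U_def using assms by (intro continuous_intros) auto
  ultimately have "open (U \<inter> g -` {0<..})" by (intro continuous_open_preimage) auto
  moreover have "petrovskii_domain \<beta> c = U \<inter> g -` {0<..}"
    by (auto simp: petrovskii_domain_def U_def g_def)
  ultimately show ?thesis by simp
qed

lemma origin_in_frontier_petrovskii_domain:
  assumes "0 < \<beta>" "0 < c" "c < 1"
  shows "(0, 0) \<in> frontier (petrovskii_domain \<beta> c :: ((real ^ 'n) \<times> real) set)"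
proof -
  have "\<exists>y\<in>petrovskii_domain \<beta> c. dist y (0 :: real ^ 'n, 0) < e" if e: "0 < e" for e
  proof -
    \<comment> \<open>Below \<open>exp (- 1)\<close> the iterated logarithm is positive, so the time axis lies in the domain.\<close>
    define h where "h = min c (min (exp (- 1)) e) / 2"
    have h: "0 < h" "h < c" "h < exp (- 1)" "h < e"
      using assms e by (auto simp: h_def min_def)
    have "ln h < - 1" using h by (metis exp_gt_zero ln_exp ln_less_cancel_iff)
    then have "0 < \<beta> * h * ln (- ln h)" using assms h by simp
    then have "(0 :: real ^ 'n, - h) \<in> petrovskii_domain \<beta> c"
      using h by (simp add: petrovskii_domain_def)
    moreover have "dist (0 :: real ^ 'n, - h) (0, 0) < e"
      using h by (simp add: dist_Pair_Pair dist_norm)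
    ultimately show ?thesis by blast
  qed
  then have "(0, 0) \<in> closure (petrovskii_domain \<beta> c :: ((real ^ 'n) \<times> real) set)"
    by (simp add: closure_approachable)
  moreover have "(0 :: real ^ 'n, 0) \<notin> petrovskii_domain \<beta> c" by (simp add: petrovskii_domain_def)
  ultimately show ?thesis
    by (simp add: frontier_def interior_open[OF open_petrovskii_domain[OF assms(3)]])
qed

text \<open>
  The domain is precisely the set where \<open>E < s\<close>, so that the factor \<open>1 - E / (2 s)\<close> lies between
  \<open>1/2\<close> and \<open>1\<close>.
\<close>

lemma petrovskii_barrier_bounds:
  assumes z: "(x, t) \<in> petrovskii_domain \<beta> c" and \<beta>: "0 < \<beta>" and c: "c < 1"
  shows "(- ln (- t)) powr (- 1 / 8) / 2 \<le> petrovskii_barrier \<beta> (x, t)"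
    and "petrovskii_barrier \<beta> (x, t) \<le> (- ln (- t)) powr (- 1 / 8)"
proof -
  note D = petrovskii_domainD[OF z \<beta> c]
  define s where "s = - ln (- t)"
  define E where "E = exp ((norm x)\<^sup>2 / (\<beta> * - t))"
  have s: "1 < s" "0 < E" "E < s" using D(3,4) by (simp_all add: s_def E_def)
  have w: "petrovskii_barrier \<beta> (x, t) = s powr (- 1 / 8) - 1 / 2 * (s powr (- 9 / 8) * E)"
    by (simp add: petrovskii_barrier_def gaussian_profile_def s_def E_def)
  have "s powr (- 9 / 8) * E \<le> s powr (- 9 / 8) * s powr 1"
    using s by (intro mult_left_mono) auto
  also have "\<dots> = s powr (- 1 / 8)" by (simp only: flip: powr_add) simp
  finally show "(- ln (- t)) powr (- 1 / 8) / 2 \<le> petrovskii_barrier \<beta> (x, t)"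
    unfolding w s_def[symmetric] by simp
  show "petrovskii_barrier \<beta> (x, t) \<le> (- ln (- t)) powr (- 1 / 8)"
    unfolding w s_def[symmetric] using s by simp
qed

lemma C2_on_petrovskii_barrier:
  "C2_on {z :: (real ^ 'n) \<times> real. - 1 < snd z \<and> snd z < 0} (petrovskii_barrier \<beta>)"
proof -
  let ?S = "{z :: (real ^ 'n) \<times> real. - 1 < snd z \<and> snd z < 0}"
  have time: "C2_on ?S snd" by (intro C2_on_bounded_linear bounded_linear_snd)
  have log: "C2_on ?S (\<lambda>z. - ln (- snd z))"
    by (rule C2_on_compose_real[OF time, where h = "\<lambda>r. - ln (- r)" and h' = "\<lambda>r. - 1 / r"
          and h'' = "\<lambda>r. 1 / r\<^sup>2"])
       (auto intro!: derivative_eq_intros continuous_intros simp: power2_eq_square)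
  have power: "C2_on ?S (\<lambda>z. (- ln (- snd z)) powr a)" for a
    by (rule C2_on_compose_real[OF log, where h = "\<lambda>r. r powr a" and h' = "\<lambda>r. a * r powr (a - 1)"
          and h'' = "\<lambda>r. a * ((a - 1) * r powr (a - 1 - 1))"])
       (auto intro!: derivative_eq_intros continuous_intros)
  have inv: "C2_on ?S (\<lambda>z. 1 / snd z)"
    by (rule C2_on_compose_real[OF time, where h = "\<lambda>r. 1 / r" and h' = "\<lambda>r. - 1 / r\<^sup>2"
          and h'' = "\<lambda>r. 2 / r ^ 3"])
       (auto intro!: derivative_eq_intros continuous_intros simp: power2_eq_square power3_eq_cube field_simps)
  have coord: "C2_on ?S (\<lambda>z. fst z $ i)" for i
    by (intro C2_on_bounded_linear bounded_linear_compose[OF bounded_linear_vec_nth bounded_linear_fst])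
  have "C2_on ?S (\<lambda>z. - 1 / \<beta> * ((\<Sum>i\<in>UNIV. fst z $ i * fst z $ i) * (1 / snd z)))"
    by (intro C2_on_mult C2_on_const C2_on_sum coord inv finite)
  moreover have eq: "- 1 / \<beta> * ((\<Sum>i\<in>UNIV. fst z $ i * fst z $ i) * (1 / snd z)) =
      (norm (fst z))\<^sup>2 / (\<beta> * - snd z)" for z :: "(real ^ 'n) \<times> real"
    by (simp add: power2_norm_eq_inner inner_vec_def)
  ultimately have "C2_on ?S (\<lambda>z. (norm (fst z))\<^sup>2 / (\<beta> * - snd z))" by (simp only: eq)
  then have "C2_on ?S (\<lambda>z. exp ((norm (fst z))\<^sup>2 / (\<beta> * - snd z)))"
    by (rule C2_on_compose_real[where h = exp and h' = exp and h'' = exp])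
       (auto intro!: derivative_eq_intros continuous_intros)
  then have "C2_on ?S (\<lambda>z. (- ln (- snd z)) powr (- 1 / 8) +
      (- 1 / 2 * (- ln (- snd z)) powr (- 9 / 8)) * exp ((norm (fst z))\<^sup>2 / (\<beta> * - snd z)))"
    by (intro C2_on_add C2_on_mult C2_on_const power)
  then show ?thesis by (simp add: petrovskii_barrier_def gaussian_profile_def case_prod_beta')
qed

text \<open>
  With \<open>s = - ln (- t)\<close> and \<open>E \<ge> 1\<close>, the time derivative of \<open>s\<^bsup>-1/8\<^esup>\<close> contributes
  \<open>- s\<^bsup>-9/8\<^esup> / 8\<close>, up to the common factor \<open>1 / (- t)\<close>. The Gaussian term contributes
  at least \<open>s\<^bsup>-9/8\<^esup> E / 4\<close>, because \<open>n + p - 2 \<ge> p - 1\<close>.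
\<close>

lemma strict_classical_supersolution_petrovskii_barrier:
  assumes p: "1 < p" and \<beta>: "\<beta> = 4 * ((p - 1) / p)"
  shows "strict_classical_supersolution p {z :: (real ^ 'n) \<times> real. - 1 < snd z \<and> snd z < 0}
    (petrovskii_barrier \<beta>)"
  unfolding strict_classical_supersolution_def
proof (intro conjI C2_on_petrovskii_barrier ballI allI impI)
  fix z :: "(real ^ 'n) \<times> real" and \<nu> :: "real ^ 'n"
  assume z: "z \<in> {z. - 1 < snd z \<and> snd z < 0}"
  assume \<nu>: "norm \<nu> = 1 \<and> spatial_gradient (petrovskii_barrier \<beta>) z =
    (spatial_gradient (petrovskii_barrier \<beta>) z \<bullet> \<nu>) *\<^sub>R \<nu>"
  obtain x t where xt: "z = (x, t)" by (cases z)
  have t: "- 1 < t" "t < 0" using z xt by auto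
  define s where "s = - ln (- t)"
  define E where "E = exp ((norm x)\<^sup>2 / (\<beta> * - t))"
  have s: "0 < s" using t by (simp add: s_def)
  have "0 < \<beta>" using p by (simp add: \<beta>)
  then have "0 < \<beta> * - t" using t by (simp add: mult_pos_neg)
  then have E: "1 \<le> E" unfolding E_def by (metis divide_nonneg_pos one_le_exp_iff zero_le_power2)
  have der: "((\<lambda>t. (- ln (- t)) powr a) has_real_derivative a * s powr (a - 1) / - t) (at t)" for a
    using t by (auto intro!: derivative_eq_intros simp: s_def)
  have A: "((\<lambda>t. (- ln (- t)) powr (- 1 / 8)) has_real_derivative - 1 / 8 * s powr (- 9 / 8) / - t) (at t)"
    using der[of "- 1 / 8"] by simp
  have B: "((\<lambda>t. - 1 / 2 * (- ln (- t)) powr (- 9 / 8)) has_real_derivative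
      9 / 16 * s powr (- 17 / 8) / - t) (at t)"
    using DERIV_cmult[OF der[of "- 9 / 8"], of "- 1 / 2"] by simp
  have B0: "- 1 / 2 * (- ln (- t)) powr (- 9 / 8) \<noteq> 0" using s by (simp add: s_def)
  define d where "d = real CARD('n) + p - 2"
  have d: "p - 1 \<le> d" by (simp add: d_def)
  have "time_derivative (petrovskii_barrier \<beta>) z
      - directional_p_laplacian p (spatial_hessian (petrovskii_barrier \<beta>) z) \<nu>
    = - 1 / 8 * s powr (- 9 / 8) / - t + E * (9 / 16 * s powr (- 17 / 8) / - t
        - (- 1 / 2 * s powr (- 9 / 8)) * d / (2 * (p - 1) * - t))"
    using parabolic_operator_gaussian_profile[OF p \<beta> t(2) B0 A B, of \<nu> x] \<nu>
    unfolding petrovskii_barrier_def xt E_def s_def d_def by simp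
  also have "\<dots> = (1 / - t) * (- 1 / 8 * s powr (- 9 / 8) + E * (9 / 16 * s powr (- 17 / 8)
        + s powr (- 9 / 8) / 4 * (d / (p - 1))))"
    using p t by (simp add: field_simps)
  also have "\<dots> > 0"
  proof (intro mult_pos_pos)
    have "s powr (- 9 / 8) / 4 * 1 \<le> s powr (- 9 / 8) / 4 * (d / (p - 1))"
      using d p by (intro mult_left_mono) auto
    then have "s powr (- 9 / 8) / 4 \<le> 9 / 16 * s powr (- 17 / 8) + s powr (- 9 / 8) / 4 * (d / (p - 1))"
      by (simp add: add_increasing)
    then have "1 * (s powr (- 9 / 8) / 4)
        \<le> E * (9 / 16 * s powr (- 17 / 8) + s powr (- 9 / 8) / 4 * (d / (p - 1)))"
      using E by (intro mult_mono) auto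
    moreover have "0 < s powr (- 9 / 8)" using s by simp
    ultimately show "0 < - 1 / 8 * s powr (- 9 / 8) + E * (9 / 16 * s powr (- 17 / 8)
        + s powr (- 9 / 8) / 4 * (d / (p - 1)))" by linarith
  qed (use t in simp)
  finally show "directional_p_laplacian p (spatial_hessian (petrovskii_barrier \<beta>) z) \<nu>
      < time_derivative (petrovskii_barrier \<beta>) z" by simp
qed

lemma petrovskii_barrier_tendsto_0:
  assumes "0 < \<beta>" "c < 1"
  shows "(petrovskii_barrier \<beta> \<longlongrightarrow> 0) (at (0, 0) within petrovskii_domain \<beta> c)"
proof (rule tendsto_sandwich[OF _ _ tendsto_const])
  let ?F = "at (0, 0) within petrovskii_domain \<beta> c :: ((real ^ 'n) \<times> real) filter"
  have "\<forall>\<^sub>F z in ?F. z \<in> petrovskii_domain \<beta> c" by (simp add: eventually_at_filter)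
  then have inside: "\<forall>\<^sub>F z in ?F. 0 \<le> petrovskii_barrier \<beta> z \<and>
      petrovskii_barrier \<beta> z \<le> (- ln (- snd z)) powr (- 1 / 8) \<and> 0 < - snd z"
  proof eventually_elim
    case (elim z)
    obtain x t where xt: "z = (x, t)" by (cases z)
    note z = elim[unfolded xt]
    show ?case
      using petrovskii_barrier_bounds[OF z assms] petrovskii_domainD[OF z assms]
      unfolding xt by (auto intro: order_trans[rotated])
  qed
  then show "\<forall>\<^sub>F z in ?F. 0 \<le> petrovskii_barrier \<beta> z"
    and "\<forall>\<^sub>F z in ?F. petrovskii_barrier \<beta> z \<le> (- ln (- snd z)) powr (- 1 / 8)"
    by (auto elim: eventually_mono)
  have "((\<lambda>z. - snd z) \<longlongrightarrow> 0) ?F"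
    by (auto intro!: tendsto_eq_intros)
  then have "filterlim (\<lambda>z. - snd z) (at_right 0) ?F"
    using inside by (auto simp: filterlim_at elim: eventually_mono)
  then have "filterlim (\<lambda>z. - ln (- snd z)) at_top ?F"
    using filterlim_compose[OF ln_at_0] by (simp add: filterlim_uminus_at_bot)
  then show "((\<lambda>z. (- ln (- snd z)) powr (- 1 / 8)) \<longlongrightarrow> 0) ?F"
    by (rule tendsto_neg_powr[rotated]) simp
qed

lemma petrovskii_barrier_away_from_origin:
  assumes \<beta>: "0 < \<beta>" and c: "c < 1" and \<delta>: "0 < \<delta>"
  shows "\<exists>m>0. \<forall>\<eta>\<in>petrovskii_domain \<beta> c. \<delta> \<le> dist \<eta> (0, 0) \<longrightarrow> m \<le> petrovskii_barrier \<beta> \<eta>"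
proof (intro exI conjI ballI impI)
  define \<rho> where "\<rho> = \<delta>\<^sup>2 / (2 * \<beta> + 1)"
  have \<rho>: "0 < \<rho>" using \<beta> \<delta> by (simp add: \<rho>_def)
  then show "0 < (2 / \<rho>) powr (- 1 / 8) / 2" by simp
  fix \<eta> :: "(real ^ 'n) \<times> real"
  assume \<eta>: "\<eta> \<in> petrovskii_domain \<beta> c" and far: "\<delta> \<le> dist \<eta> (0, 0)"
  obtain x t where xt: "\<eta> = (x, t)" by (cases \<eta>)
  note z = \<eta>[unfolded xt]
  note D = petrovskii_domainD[OF z \<beta> c]
  have "\<delta> \<le> norm (x, t)" using far by (simp add: xt dist_norm)
  then have "\<delta>\<^sup>2 \<le> (norm (x, t))\<^sup>2" using \<delta> by (intro power_mono) auto
  also have "\<dots> \<le> (2 * \<beta> + 1) * sqrt (- t)" by (rule petrovskii_domain_norm_bound[OF z \<beta> c])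
  finally have "\<rho> \<le> sqrt (- t)" using \<beta> by (simp add: \<rho>_def pos_divide_le_eq mult.commute)
  then have "2 / sqrt (- t) \<le> 2 / \<rho>" using \<rho> D(2) by (intro divide_left_mono) auto
  then have "- ln (- t) \<le> 2 / \<rho>" using neg_ln_le_inverse_sqrt[of "- t"] D(2) by linarith
  then have "(2 / \<rho>) powr (- 1 / 8) \<le> (- ln (- t)) powr (- 1 / 8)"
    using D(3) by (intro powr_mono2') auto
  then show "(2 / \<rho>) powr (- 1 / 8) / 2 \<le> petrovskii_barrier \<beta> \<eta>"
    using petrovskii_barrier_bounds(1)[OF z \<beta> c] by (simp add: xt)
qed

theorem theorem1p2:
  fixes p \<beta> c :: real and \<Omega> :: "((real ^ 'n) \<times> real) set"
  assumes "1 < p" and "0 < c" and "c < 1"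
    and "\<beta> = 4 * ((p - 1) / p)"
    and "\<Omega> = {(x, t). - c < t \<and> t < 0 \<and> (norm x)\<^sup>2 < - \<beta> * t * ln \<bar>ln \<bar>t\<bar>\<bar>}"
  shows "regular_boundary_point p \<Omega> (0, 0)"
proof -
  have \<beta>: "0 < \<beta>" using assms(1,4) by simp
  have "ln \<bar>ln \<bar>t\<bar>\<bar> = ln (- ln (- t))" if "- c < t" "t < 0" for t :: real
    using that assms(3) by (simp add: abs_of_neg)
  then have \<Omega>: "\<Omega> = petrovskii_domain \<beta> c"
    unfolding assms(5) petrovskii_domain_def by auto
  have sub: "petrovskii_domain \<beta> c \<subseteq> {z :: (real ^ 'n) \<times> real. - 1 < snd z \<and> snd z < 0}"
    using assms(3) by (auto simp: petrovskii_domain_def)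
  have pos: "0 < petrovskii_barrier \<beta> \<eta>" and le: "petrovskii_barrier \<beta> \<eta> \<le> 1"
    if \<eta>: "\<eta> \<in> petrovskii_domain \<beta> c" for \<eta> :: "(real ^ 'n) \<times> real"
  proof -
    obtain x t where xt: "\<eta> = (x, t)" by (cases \<eta>)
    note z = \<eta>[unfolded xt]
    note b = petrovskii_barrier_bounds[OF z \<beta> assms(3)] and D = petrovskii_domainD[OF z \<beta> assms(3)]
    have "0 < (- ln (- t)) powr (- 1 / 8)" using D(3) by simp
    then show "0 < petrovskii_barrier \<beta> \<eta>" using b(1) unfolding xt by linarith
    have "(- ln (- t)) powr (- 1 / 8) \<le> (- ln (- t)) powr 0" using D(3) by (intro powr_mono) auto
    then show "petrovskii_barrier \<beta> \<eta> \<le> 1" using b(2) D(3) by (simp add: xt)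
  qed
  have super: "strict_classical_supersolution p (petrovskii_domain \<beta> c :: ((real ^ 'n) \<times> real) set)
      (petrovskii_barrier \<beta>)"
    using strict_classical_supersolution_petrovskii_barrier[OF assms(1,4)] sub C2_on_subset[OF _ sub]
    unfolding strict_classical_supersolution_def by blast
  show ?thesis
    unfolding \<Omega>
    by (rule regular_boundary_point_if_barrier[OF assms(1) open_petrovskii_domain[OF assms(3)]
          bounded_petrovskii_domain[OF \<beta> assms(3)]
          origin_in_frontier_petrovskii_domain[OF \<beta> assms(2,3)] super pos le
          petrovskii_barrier_tendsto_0[OF \<beta> assms(3)]
          petrovskii_barrier_away_from_origin[OF \<beta> assms(3)]])
qed

end
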